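(* Let $f\colon\mathcal{P}\to\mathcal{Q}$ be a map of posets, let $\mathcal{Q}$ be equipped with a superlinear family of translations $T_\bullet$, and let $\mathbf{C}$ be a cocomplete category. Then for all $\mathcal{Q}$-modules $M,N\in\mathrm{Fun}(\mathcal{Q},\mathbf{C})$, $$|d_{\mathcal{Q}}(M,N)-d_{\mathcal{P}}(f^*M,f^*N)|\le d_{\mathcal{Q}}(M,f_*f^*M)+d_{\mathcal{Q}}(N,f_*f^*N),$$ where $d_{\mathcal{Q}}$ is the weak interleaving distance over $\mathcal{Q}$ and $d_{\mathcal{P}}=d_f$ is the weak relative interleaving distance over $\mathcal{P}$.
   Context: Posets are viewed as categories; a map of posets is a monotone map. For a poset $\mathcal{P}$ and a category $\mathbf{C}$, a $\mathcal{P}$-module is a functor $\mathcal{P}\to\mathbf{C}$. Pullback and pushforward: for a map of posets $f\colon\mathcal{P}\to\mathcal{Q}$, $f^*M=M\circ f$, and $f_*M=\mathrm{Lan}_fM$, i.e. $(f_*M)(q)=\varinjlim_{p\,:\,f(p)\le q}M(p)$. The functor $f_*$ is left adjoint to $f^*$, with unit $\upsilon\colon\mathrm{id}\Rightarrow f^*f_*$ and counit $\chi\colon f_*f^*\Rightarrow\mathrm{id}$. Translations: a translation on $\mathcal{Q}$ is a monotone map $T\colon\mathcal{Q}\to\mathcal{Q}$ with $q\le T(q)$ for all $q$. A superlinear family of translations is an assignment $\varepsilon\mapsto T_\varepsilon$, $\varepsilon\in[0,\infty)$, of translations with $T_{\varepsilon_2}\circ T_{\varepsilon_1}\le T_{\varepsilon_1+\varepsilon_2}$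 pointwise (hence $T_\varepsilon\le T_{\varepsilon'}$ when $\varepsilon\le\varepsilon'$). Weak interleavings over $\mathcal{Q}$: $(M)^\varepsilon_{\mathcal{Q}}=M\circ T_\varepsilon$ (with $\varphi^\varepsilon=T_\varepsilon^*\varphi$). The internal maps of $M$ give natural maps $\eta^\varepsilon_{\mathcal{Q}}\colon M\to(M)^\varepsilon_{\mathcal{Q}}$, $\eta^{\varepsilon,\varepsilon'}_{\mathcal{Q}}\colon(M)^\varepsilon_{\mathcal{Q}}\to(M)^{\varepsilon'}_{\mathcal{Q}}$ for $\varepsilon\le\varepsilon'$, and $\Sigma^{\varepsilon_1,\varepsilon_2}_{\mathcal{Q}}\colon((M)^{\varepsilon_1}_{\mathcal{Q}})^{\varepsilon_2}_{\mathcal{Q}}\to(M)^{\varepsilon_1+\varepsilon_2}_{\mathcal{Q}}$. A weak $\varepsilon$-interleaving of $M,N$ is a pair $\varphi\colon M\to(N)^\varepsilon_{\mathcal{Q}}$, $\psi\colon N\to(M)^\varepsilon_{\mathcal{Q}}$ with $\Sigma^{\varepsilon,\varepsilon}_{\mathcal{Q}}\circ\psi^\varepsilon\circ\varphi=\eta^{0,2\varepsilon}_{\mathcal{Q}}\circ\eta^0_{\mathcal{Q}}$ on $M$ and symmetrically on $N$. $d_{\mathcal{Q}}(M,N)$ is the infimum of $\varepsilon\ge0$ for which one exists ($\infty$ if none). Weak interleavings relative to $f$: $(M)^\varepsilon_{\mathcal{P}}=f^*T_\varepsilon^*f_*M$ (with $\varphi^\varepsilon=f^*T_\varepsilon^*f_*\varphi$).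 Let $\eta^\varepsilon_{\mathcal{P}}$ be $M\xrightarrow{\upsilon}f^*f_*M\xrightarrow{f^*\eta^\varepsilon_{\mathcal{Q}}}f^*T_\varepsilon^*f_*M$, $\eta^{\varepsilon,\varepsilon'}_{\mathcal{P}}=f^*\eta^{\varepsilon,\varepsilon'}_{\mathcal{Q}}f_*$, and $\Sigma^{\varepsilon_1,\varepsilon_2}_{\mathcal{P}}$ the composite $$f^*T_{\varepsilon_2}^*f_*f^*T_{\varepsilon_1}^*f_*M\xrightarrow{f^*T_{\varepsilon_2}^*\chi}f^*T_{\varepsilon_2}^*T_{\varepsilon_1}^*f_*M\xrightarrow{f^*\Sigma_{\mathcal{Q}}^{\varepsilon_1,\varepsilon_2}}f^*T_{\varepsilon_1+\varepsilon_2}^*f_*M.$$ A weak $\varepsilon$-interleaving relative to $f$ of $M,N$ is a pair $\varphi\colon M\to(N)^\varepsilon_{\mathcal{P}}$, $\psi\colon N\to(M)^\varepsilon_{\mathcal{P}}$ with $\Sigma^{\varepsilon,\varepsilon}_{\mathcal{P}}\circ\psi^\varepsilon\circ\varphi=\eta^{0,2\varepsilon}_{\mathcal{P}}\circ\eta^0_{\mathcal{P}}$ on $M$ and symmetrically on $N$. $d_f(M,N)$ is the infimum of $\varepsilon\ge0$ for which one exists ($\infty$ if none). Distances take values in $[0,\infty]$; an inequality $|a-b|\le c$ means $a\le b+c$ and $b\le a+c$. *)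

theory Defs
  imports Complex_Main "HOL-Library.Extended_Nonnegative_Real"
begin

section \<open>Categories, functors, natural transformations\<close>

record ('o, 'a) category =
  Obj :: "'o set"
  Arr :: "'a set"
  Dom :: "'a \<Rightarrow> 'o"
  Cod :: "'a \<Rightarrow> 'o"
  Id :: "'o \<Rightarrow> 'a"
  Comp :: "'a \<Rightarrow> 'a \<Rightarrow> 'a"  (infixr \<open>\<cdot>\<index>\<close> 70)

definition Hom :: "('o, 'a) category \<Rightarrow> 'o \<Rightarrow> 'o \<Rightarrow> 'a set" where
  "Hom C x y = {a \<in> Arr C. Dom C a = x \<and> Cod C a = y}"

definition is_category :: "('o, 'a) category \<Rightarrow> bool" where
  "is_category C \<longleftrightarrow>
     (\<forall>a\<in>Arr C. Dom C a \<in> Obj C \<and> Cod C a \<in> Obj C) \<and>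
     (\<forall>x\<in>Obj C. Id C x \<in> Hom C x x) \<and>
     (\<forall>x\<in>Obj C. \<forall>y\<in>Obj C. \<forall>z\<in>Obj C. \<forall>a\<in>Hom C x y. \<forall>b\<in>Hom C y z. b \<cdot>\<^bsub>C\<^esub> a \<in> Hom C x z) \<and>
     (\<forall>x\<in>Obj C. \<forall>y\<in>Obj C. \<forall>a\<in>Hom C x y. a \<cdot>\<^bsub>C\<^esub> Id C x = a \<and> Id C y \<cdot>\<^bsub>C\<^esub> a = a) \<and>
     (\<forall>w\<in>Obj C. \<forall>x\<in>Obj C. \<forall>y\<in>Obj C. \<forall>z\<in>Obj C.
        \<forall>a\<in>Hom C w x. \<forall>b\<in>Hom C x y. \<forall>c\<in>Hom C y z. (c \<cdot>\<^bsub>C\<^esub> b) \<cdot>\<^bsub>C\<^esub> a = c \<cdot>\<^bsub>C\<^esub> (b \<cdot>\<^bsub>C\<^esub> a))"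

record ('i, 'j, 'o, 'a) functr =
  FObj :: "'i \<Rightarrow> 'o"
  FArr :: "'j \<Rightarrow> 'a"

definition is_functor ::
  "('i, 'j) category \<Rightarrow> ('o, 'a) category \<Rightarrow> ('i, 'j, 'o, 'a) functr \<Rightarrow> bool" where
  "is_functor J C F \<longleftrightarrow>
     (\<forall>x\<in>Obj J. FObj F x \<in> Obj C) \<and>
     (\<forall>x\<in>Obj J. \<forall>y\<in>Obj J. \<forall>a\<in>Hom J x y. FArr F a \<in> Hom C (FObj F x) (FObj F y)) \<and>
     (\<forall>x\<in>Obj J. FArr F (Id J x) = Id C (FObj F x)) \<and>
     (\<forall>x\<in>Obj J. \<forall>y\<in>Obj J. \<forall>z\<in>Obj J. \<forall>a\<in>Hom J x y. \<forall>b\<in>Hom J y z.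
        FArr F (b \<cdot>\<^bsub>J\<^esub> a) = FArr F b \<cdot>\<^bsub>C\<^esub> FArr F a)"

text \<open>A natural transformation is given by its components; only the components at objects of
  the source category are meaningful.\<close>

definition is_nat_trans ::
  "('i, 'j) category \<Rightarrow> ('o, 'a) category \<Rightarrow> ('i, 'j, 'o, 'a) functr \<Rightarrow> ('i, 'j, 'o, 'a) functr
    \<Rightarrow> ('i \<Rightarrow> 'a) \<Rightarrow> bool" where
  "is_nat_trans J C F G \<tau> \<longleftrightarrow>
     (\<forall>x\<in>Obj J. \<tau> x \<in> Hom C (FObj F x) (FObj G x)) \<and>
     (\<forall>x\<in>Obj J. \<forall>y\<in>Obj J. \<forall>a\<in>Hom J x y. \<tau> y \<cdot>\<^bsub>C\<^esub> FArr F a = FArr G a \<cdot>\<^bsub>C\<^esub> \<tau> x)"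

definition nt_comp :: "('o, 'a) category \<Rightarrow> ('i \<Rightarrow> 'a) \<Rightarrow> ('i \<Rightarrow> 'a) \<Rightarrow> 'i \<Rightarrow> 'a" where
  "nt_comp C \<tau> \<sigma> = (\<lambda>x. \<tau> x \<cdot>\<^bsub>C\<^esub> \<sigma> x)"


section \<open>Colimits\<close>

definition is_cocone ::
  "('i, 'j) category \<Rightarrow> ('o, 'a) category \<Rightarrow> ('i, 'j, 'o, 'a) functr \<Rightarrow> 'o \<Rightarrow> ('i \<Rightarrow> 'a) \<Rightarrow> bool" where
  "is_cocone J C D c \<iota> \<longleftrightarrow>
     c \<in> Obj C \<and>
     (\<forall>x\<in>Obj J. \<iota> x \<in> Hom C (FObj D x) c) \<and>
     (\<forall>x\<in>Obj J. \<forall>y\<in>Obj J. \<forall>a\<in>Hom J x y. \<iota> y \<cdot>\<^bsub>C\<^esub> FArr D a = \<iota> x)"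

definition is_colimit ::
  "('i, 'j) category \<Rightarrow> ('o, 'a) category \<Rightarrow> ('i, 'j, 'o, 'a) functr \<Rightarrow> 'o \<Rightarrow> ('i \<Rightarrow> 'a) \<Rightarrow> bool" where
  "is_colimit J C D c \<iota> \<longleftrightarrow>
     is_cocone J C D c \<iota> \<and>
     (\<forall>d \<kappa>. is_cocone J C D d \<kappa> \<longrightarrow>
        (\<exists>!h. h \<in> Hom C c d \<and> (\<forall>x\<in>Obj J. h \<cdot>\<^bsub>C\<^esub> \<iota> x = \<kappa> x)))"

text \<open>HOL cannot quantify over all types, so smallness is relative to two types: the index
  categories are those with objects in \<open>'i\<close> and arrows in \<open>'j\<close>.\<close>

definition cocomplete :: "'i itself \<Rightarrow> 'j itself \<Rightarrow> ('o, 'a) category \<Rightarrow> bool" where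
  "cocomplete _ _ C \<longleftrightarrow>
     (\<forall>(J :: ('i, 'j) category) D. is_category J \<longrightarrow> is_functor J C D \<longrightarrow>
        (\<exists>c \<iota>. is_colimit J C D c \<iota>))"

text \<open>A chosen colimit with its coprojections, and the arrow out of it induced by a cocone.
  These are meaningful only for diagrams that have a colimit.\<close>

definition some_colimit ::
  "('i, 'j) category \<Rightarrow> ('o, 'a) category \<Rightarrow> ('i, 'j, 'o, 'a) functr \<Rightarrow> 'o \<times> ('i \<Rightarrow> 'a)" where
  "some_colimit J C D = (SOME L. is_colimit J C D (fst L) (snd L))"

definition colim ::
  "('i, 'j) category \<Rightarrow> ('o, 'a) category \<Rightarrow> ('i, 'j, 'o, 'a) functr \<Rightarrow> 'o" where
  "colim J C D = fst (some_colimit J C D)"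

definition coproj ::
  "('i, 'j) category \<Rightarrow> ('o, 'a) category \<Rightarrow> ('i, 'j, 'o, 'a) functr \<Rightarrow> 'i \<Rightarrow> 'a" where
  "coproj J C D = snd (some_colimit J C D)"

definition colim_desc ::
  "('i, 'j) category \<Rightarrow> ('o, 'a) category \<Rightarrow> ('i, 'j, 'o, 'a) functr \<Rightarrow> 'o \<Rightarrow> ('i \<Rightarrow> 'a) \<Rightarrow> 'a" where
  "colim_desc J C D d \<kappa> =
     (THE h. h \<in> Hom C (colim J C D) d \<and> (\<forall>x\<in>Obj J. h \<cdot>\<^bsub>C\<^esub> coproj J C D x = \<kappa> x))"


section \<open>Posets and modules over them\<close>

text \<open>A poset is a subset of a partially ordered type with the induced order (so that the empty
  poset is included). As a category, its arrow \<open>x \<rightarrow> y\<close> is the pair \<open>(x, y)\<close> with \<open>x \<le> y\<close>.\<close>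

definition poset_cat :: "'p::order set \<Rightarrow> ('p, 'p \<times> 'p) category" where
  "poset_cat P = \<lparr>Obj = P, Arr = {(x, y). x \<in> P \<and> y \<in> P \<and> x \<le> y}, Dom = fst, Cod = snd,
     Id = (\<lambda>x. (x, x)), Comp = (\<lambda>b a. (fst a, snd b))\<rparr>"

definition poset_map :: "'p::order set \<Rightarrow> 'q::order set \<Rightarrow> ('p \<Rightarrow> 'q) \<Rightarrow> bool" where
  "poset_map P Q f \<longleftrightarrow> f ` P \<subseteq> Q \<and> mono_on P f"

type_synonym ('p, 'o, 'a) pmodule = "('p, 'p \<times> 'p, 'o, 'a) functr"

definition is_module :: "'p::order set \<Rightarrow> ('o, 'a) category \<Rightarrow> ('p, 'o, 'a) pmodule \<Rightarrow> bool" where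
  "is_module P C M \<longleftrightarrow> is_functor (poset_cat P) C M"

abbreviation is_module_hom ::
  "'p::order set \<Rightarrow> ('o, 'a) category \<Rightarrow> ('p, 'o, 'a) pmodule \<Rightarrow> ('p, 'o, 'a) pmodule
    \<Rightarrow> ('p \<Rightarrow> 'a) \<Rightarrow> bool" where
  "is_module_hom P C M N \<phi> \<equiv> is_nat_trans (poset_cat P) C M N \<phi>"


section \<open>Pullback and pushforward\<close>

definition pullback :: "('p \<Rightarrow> 'q) \<Rightarrow> ('q, 'o, 'a) pmodule \<Rightarrow> ('p, 'o, 'a) pmodule" where
  "pullback f M = \<lparr>FObj = (\<lambda>p. FObj M (f p)), FArr = (\<lambda>(x, y). FArr M (f x, f y))\<rparr>"

definition pullback_hom :: "('p \<Rightarrow> 'q) \<Rightarrow> ('q \<Rightarrow> 'a) \<Rightarrow> 'p \<Rightarrow> 'a" where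
  "pullback_hom f \<phi> = (\<lambda>p. \<phi> (f p))"

definition below :: "'p::order set \<Rightarrow> ('p \<Rightarrow> 'q::order) \<Rightarrow> 'q \<Rightarrow> ('p, 'p \<times> 'p) category" where
  "below P f q = poset_cat {p \<in> P. f p \<le> q}"

text \<open>The pointwise left Kan extension along \<open>f\<close>: its value at \<open>q\<close> is the colimit of \<open>M p\<close> over
  the \<open>p\<close> with \<open>f p \<le> q\<close>. The functions \<open>FObj M\<close>, \<open>FArr M\<close> themselves serve as the diagram
  obtained by restricting \<open>M\<close>.\<close>

definition pushforward ::
  "'p::order set \<Rightarrow> ('p \<Rightarrow> 'q::order) \<Rightarrow> ('o, 'a) category \<Rightarrow> ('p, 'o, 'a) pmodule
    \<Rightarrow> ('q, 'o, 'a) pmodule" where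
  "pushforward P f C M =
     \<lparr>FObj = (\<lambda>q. colim (below P f q) C M),
      FArr = (\<lambda>(q, q'). colim_desc (below P f q) C M
                (colim (below P f q') C M) (coproj (below P f q') C M))\<rparr>"

definition pushforward_hom ::
  "'p::order set \<Rightarrow> ('p \<Rightarrow> 'q::order) \<Rightarrow> ('o, 'a) category \<Rightarrow> ('p, 'o, 'a) pmodule
    \<Rightarrow> ('p, 'o, 'a) pmodule \<Rightarrow> ('p \<Rightarrow> 'a) \<Rightarrow> 'q \<Rightarrow> 'a" where
  "pushforward_hom P f C M N \<phi> =
     (\<lambda>q. colim_desc (below P f q) C M (colim (below P f q) C N)
            (\<lambda>p. coproj (below P f q) C N p \<cdot>\<^bsub>C\<^esub> \<phi> p))"

text \<open>The unit \<open>M \<rightarrow> f\<^sup>* f\<^sub>* M\<close> and the counit \<open>f\<^sub>* f\<^sup>* M \<rightarrow> M\<close> of the adjunction.\<close>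

definition unit_hom ::
  "'p::order set \<Rightarrow> ('p \<Rightarrow> 'q::order) \<Rightarrow> ('o, 'a) category \<Rightarrow> ('p, 'o, 'a) pmodule \<Rightarrow> 'p \<Rightarrow> 'a" where
  "unit_hom P f C M = (\<lambda>p. coproj (below P f (f p)) C M p)"

definition counit_hom ::
  "'p::order set \<Rightarrow> ('p \<Rightarrow> 'q::order) \<Rightarrow> ('o, 'a) category \<Rightarrow> ('q, 'o, 'a) pmodule \<Rightarrow> 'q \<Rightarrow> 'a" where
  "counit_hom P f C M =
     (\<lambda>q. colim_desc (below P f q) C (pullback f M) (FObj M q) (\<lambda>p. FArr M (f p, q)))"


section \<open>Weak interleavings over a poset with translations\<close>

definition translation :: "'q::order set \<Rightarrow> ('q \<Rightarrow> 'q) \<Rightarrow> bool" where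
  "translation Q T \<longleftrightarrow> poset_map Q Q T \<and> (\<forall>q\<in>Q. q \<le> T q)"

text \<open>The family is indexed by \<open>[0, \<infinity>)\<close>; the values \<open>T \<epsilon>\<close> for negative \<open>\<epsilon>\<close> are irrelevant.\<close>

definition superlinear_family :: "'q::order set \<Rightarrow> (real \<Rightarrow> 'q \<Rightarrow> 'q) \<Rightarrow> bool" where
  "superlinear_family Q T \<longleftrightarrow>
     (\<forall>\<epsilon>\<ge>0. translation Q (T \<epsilon>)) \<and>
     (\<forall>\<epsilon>1\<ge>0. \<forall>\<epsilon>2\<ge>0. \<forall>q\<in>Q. T \<epsilon>2 (T \<epsilon>1 q) \<le> T (\<epsilon>1 + \<epsilon>2) q)"

definition shiftQ ::
  "(real \<Rightarrow> 'q \<Rightarrow> 'q) \<Rightarrow> real \<Rightarrow> ('q, 'o, 'a) pmodule \<Rightarrow> ('q, 'o, 'a) pmodule" where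
  "shiftQ T \<epsilon> M = pullback (T \<epsilon>) M"

definition shiftQ_hom :: "(real \<Rightarrow> 'q \<Rightarrow> 'q) \<Rightarrow> real \<Rightarrow> ('q \<Rightarrow> 'a) \<Rightarrow> 'q \<Rightarrow> 'a" where
  "shiftQ_hom T \<epsilon> \<phi> = pullback_hom (T \<epsilon>) \<phi>"

definition etaQ :: "(real \<Rightarrow> 'q \<Rightarrow> 'q) \<Rightarrow> real \<Rightarrow> ('q, 'o, 'a) pmodule \<Rightarrow> 'q \<Rightarrow> 'a" where
  "etaQ T \<epsilon> M = (\<lambda>q. FArr M (q, T \<epsilon> q))"

definition etaQ2 :: "(real \<Rightarrow> 'q \<Rightarrow> 'q) \<Rightarrow> real \<Rightarrow> real \<Rightarrow> ('q, 'o, 'a) pmodule \<Rightarrow> 'q \<Rightarrow> 'a" where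
  "etaQ2 T \<epsilon> \<epsilon>' M = (\<lambda>q. FArr M (T \<epsilon> q, T \<epsilon>' q))"

definition SigmaQ :: "(real \<Rightarrow> 'q \<Rightarrow> 'q) \<Rightarrow> real \<Rightarrow> real \<Rightarrow> ('q, 'o, 'a) pmodule \<Rightarrow> 'q \<Rightarrow> 'a" where
  "SigmaQ T \<epsilon>1 \<epsilon>2 M = (\<lambda>q. FArr M (T \<epsilon>1 (T \<epsilon>2 q), T (\<epsilon>1 + \<epsilon>2) q))"

definition weak_interleavingQ ::
  "'q::order set \<Rightarrow> (real \<Rightarrow> 'q \<Rightarrow> 'q) \<Rightarrow> ('o, 'a) category \<Rightarrow> real
    \<Rightarrow> ('q, 'o, 'a) pmodule \<Rightarrow> ('q, 'o, 'a) pmodule \<Rightarrow> ('q \<Rightarrow> 'a) \<Rightarrow> ('q \<Rightarrow> 'a) \<Rightarrow> bool" where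
  "weak_interleavingQ Q T C \<epsilon> M N \<phi> \<psi> \<longleftrightarrow>
     is_module_hom Q C M (shiftQ T \<epsilon> N) \<phi> \<and>
     is_module_hom Q C N (shiftQ T \<epsilon> M) \<psi> \<and>
     (\<forall>q\<in>Q. nt_comp C (SigmaQ T \<epsilon> \<epsilon> M) (nt_comp C (shiftQ_hom T \<epsilon> \<psi>) \<phi>) q
           = nt_comp C (etaQ2 T 0 (2 * \<epsilon>) M) (etaQ T 0 M) q) \<and>
     (\<forall>q\<in>Q. nt_comp C (SigmaQ T \<epsilon> \<epsilon> N) (nt_comp C (shiftQ_hom T \<epsilon> \<phi>) \<psi>) q
           = nt_comp C (etaQ2 T 0 (2 * \<epsilon>) N) (etaQ T 0 N) q)"

definition distQ ::
  "'q::order set \<Rightarrow> (real \<Rightarrow> 'q \<Rightarrow> 'q) \<Rightarrow> ('o, 'a) category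
    \<Rightarrow> ('q, 'o, 'a) pmodule \<Rightarrow> ('q, 'o, 'a) pmodule \<Rightarrow> ennreal" where
  "distQ Q T C M N = Inf {ennreal \<epsilon> |\<epsilon>. 0 \<le> \<epsilon> \<and> (\<exists>\<phi> \<psi>. weak_interleavingQ Q T C \<epsilon> M N \<phi> \<psi>)}"


section \<open>Weak interleavings relative to a map of posets\<close>

definition shiftP ::
  "'p::order set \<Rightarrow> ('p \<Rightarrow> 'q::order) \<Rightarrow> (real \<Rightarrow> 'q \<Rightarrow> 'q) \<Rightarrow> ('o, 'a) category \<Rightarrow> real
    \<Rightarrow> ('p, 'o, 'a) pmodule \<Rightarrow> ('p, 'o, 'a) pmodule" where
  "shiftP P f T C \<epsilon> M = pullback f (shiftQ T \<epsilon> (pushforward P f C M))"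

definition shiftP_hom ::
  "'p::order set \<Rightarrow> ('p \<Rightarrow> 'q::order) \<Rightarrow> (real \<Rightarrow> 'q \<Rightarrow> 'q) \<Rightarrow> ('o, 'a) category \<Rightarrow> real
    \<Rightarrow> ('p, 'o, 'a) pmodule \<Rightarrow> ('p, 'o, 'a) pmodule \<Rightarrow> ('p \<Rightarrow> 'a) \<Rightarrow> 'p \<Rightarrow> 'a" where
  "shiftP_hom P f T C \<epsilon> M N \<phi> = pullback_hom f (shiftQ_hom T \<epsilon> (pushforward_hom P f C M N \<phi>))"

definition etaP ::
  "'p::order set \<Rightarrow> ('p \<Rightarrow> 'q::order) \<Rightarrow> (real \<Rightarrow> 'q \<Rightarrow> 'q) \<Rightarrow> ('o, 'a) category \<Rightarrow> real
    \<Rightarrow> ('p, 'o, 'a) pmodule \<Rightarrow> 'p \<Rightarrow> 'a" where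
  "etaP P f T C \<epsilon> M =
     nt_comp C (pullback_hom f (etaQ T \<epsilon> (pushforward P f C M))) (unit_hom P f C M)"

definition etaP2 ::
  "'p::order set \<Rightarrow> ('p \<Rightarrow> 'q::order) \<Rightarrow> (real \<Rightarrow> 'q \<Rightarrow> 'q) \<Rightarrow> ('o, 'a) category \<Rightarrow> real \<Rightarrow> real
    \<Rightarrow> ('p, 'o, 'a) pmodule \<Rightarrow> 'p \<Rightarrow> 'a" where
  "etaP2 P f T C \<epsilon> \<epsilon>' M = pullback_hom f (etaQ2 T \<epsilon> \<epsilon>' (pushforward P f C M))"

definition SigmaP ::
  "'p::order set \<Rightarrow> ('p \<Rightarrow> 'q::order) \<Rightarrow> (real \<Rightarrow> 'q \<Rightarrow> 'q) \<Rightarrow> ('o, 'a) category \<Rightarrow> real \<Rightarrow> real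
    \<Rightarrow> ('p, 'o, 'a) pmodule \<Rightarrow> 'p \<Rightarrow> 'a" where
  "SigmaP P f T C \<epsilon>1 \<epsilon>2 M =
     nt_comp C (pullback_hom f (SigmaQ T \<epsilon>1 \<epsilon>2 (pushforward P f C M)))
       (pullback_hom f (shiftQ_hom T \<epsilon>2 (counit_hom P f C (shiftQ T \<epsilon>1 (pushforward P f C M)))))"

definition weak_interleavingP ::
  "'p::order set \<Rightarrow> ('p \<Rightarrow> 'q::order) \<Rightarrow> (real \<Rightarrow> 'q \<Rightarrow> 'q) \<Rightarrow> ('o, 'a) category \<Rightarrow> real
    \<Rightarrow> ('p, 'o, 'a) pmodule \<Rightarrow> ('p, 'o, 'a) pmodule \<Rightarrow> ('p \<Rightarrow> 'a) \<Rightarrow> ('p \<Rightarrow> 'a) \<Rightarrow> bool" where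
  "weak_interleavingP P f T C \<epsilon> M N \<phi> \<psi> \<longleftrightarrow>
     is_module_hom P C M (shiftP P f T C \<epsilon> N) \<phi> \<and>
     is_module_hom P C N (shiftP P f T C \<epsilon> M) \<psi> \<and>
     (\<forall>p\<in>P. nt_comp C (SigmaP P f T C \<epsilon> \<epsilon> M)
                (nt_comp C (shiftP_hom P f T C \<epsilon> N (shiftP P f T C \<epsilon> M) \<psi>) \<phi>) p
           = nt_comp C (etaP2 P f T C 0 (2 * \<epsilon>) M) (etaP P f T C 0 M) p) \<and>
     (\<forall>p\<in>P. nt_comp C (SigmaP P f T C \<epsilon> \<epsilon> N)
                (nt_comp C (shiftP_hom P f T C \<epsilon> M (shiftP P f T C \<epsilon> N) \<phi>) \<psi>) p
           = nt_comp C (etaP2 P f T C 0 (2 * \<epsilon>) N) (etaP P f T C 0 N) p)"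

definition distP ::
  "'p::order set \<Rightarrow> ('p \<Rightarrow> 'q::order) \<Rightarrow> (real \<Rightarrow> 'q \<Rightarrow> 'q) \<Rightarrow> ('o, 'a) category
    \<Rightarrow> ('p, 'o, 'a) pmodule \<Rightarrow> ('p, 'o, 'a) pmodule \<Rightarrow> ennreal" where
  "distP P f T C M N = Inf {ennreal \<epsilon> |\<epsilon>. 0 \<le> \<epsilon> \<and> (\<exists>\<phi> \<psi>. weak_interleavingP P f T C \<epsilon> M N \<phi> \<psi>)}"

end

theory Submission
  imports Defs
begin

text \<open>
  The relative distance is an absolute distance in disguise: for \<open>\<P>\<close>-modules \<open>A\<close> and \<open>B\<close>,
  \<open>d\<^sub>f(A, B) = d\<^sub>Q(f\<^sub>* A, f\<^sub>* B)\<close> (\<open>distP_eq_distQ_push\<close>). Indeed, a map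
  \<open>\<phi> : A \<rightarrow> f\<^sup>* T\<^sub>\<epsilon>\<^sup>* f\<^sub>* B\<close> is the same datum as its adjunct
  \<open>\<Phi> = \<chi> \<circ> f\<^sub>* \<phi> : f\<^sub>* A \<rightarrow> T\<^sub>\<epsilon>\<^sup>* f\<^sub>* B\<close>. The counit in the relative \<open>\<Sigma>\<close> is exactly what turns
  \<open>f\<^sub>* \<psi>\<close> into the adjunct \<open>\<Psi>\<close>, so either side of the relative interleaving equation is the restriction
  along the unit of the corresponding side of the absolute equation for \<open>\<Phi>, \<Psi>\<close>. Maps out of \<open>f\<^sub>* A\<close>
  are determined by such restrictions, so the two equations are equivalent.

  The absolute distance is symmetric and satisfies the triangle inequality, because interleavings
  compose: the composite of an \<open>a\<close>- and a \<open>b\<close>-interleaving naturally lands in \<open>T\<^sub>b T\<^sub>a\<close>, and superlinearity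
  pushes it on to \<open>T\<^bsub>a+b\<^esub>\<close> (\<open>distQ_triangle\<close>). The two inequalities of the theorem are then two
  applications of the triangle inequality each, along the paths
  \<open>M, f\<^sub>* f\<^sup>* M, f\<^sub>* f\<^sup>* N, N\<close> and \<open>f\<^sub>* f\<^sup>* M, M, N, f\<^sub>* f\<^sup>* N\<close>.
\<close>

section \<open>Categories and modules\<close>

locale lawful_category =
  fixes C :: "('o, 'a) category" (structure)
  assumes cat: "is_category C"
begin

lemma hom_objD:
  assumes "a \<in> Hom C x y"
  shows "x \<in> Obj C" "y \<in> Obj C"
proof -
  have "\<forall>a\<in>Arr C. Dom C a \<in> Obj C \<and> Cod C a \<in> Obj C"
    using cat unfolding is_category_def by (elim conjE)
  then show "x \<in> Obj C" "y \<in> Obj C"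
    using assms by (auto simp: Hom_def)
qed

lemma comp_hom:
  assumes "a \<in> Hom C x y" "b \<in> Hom C y z"
  shows "b \<cdot> a \<in> Hom C x z"
proof -
  have "\<forall>x\<in>Obj C. \<forall>y\<in>Obj C. \<forall>z\<in>Obj C. \<forall>a\<in>Hom C x y. \<forall>b\<in>Hom C y z. b \<cdot> a \<in> Hom C x z"
    using cat unfolding is_category_def by (elim conjE)
  then show ?thesis
    using assms hom_objD by blast
qed

lemma comp_assoc:
  assumes "a \<in> Hom C w x" "b \<in> Hom C x y" "c \<in> Hom C y z"
  shows "(c \<cdot> b) \<cdot> a = c \<cdot> (b \<cdot> a)"
proof -
  have "\<forall>w\<in>Obj C. \<forall>x\<in>Obj C. \<forall>y\<in>Obj C. \<forall>z\<in>Obj C.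
      \<forall>a\<in>Hom C w x. \<forall>b\<in>Hom C x y. \<forall>c\<in>Hom C y z. (c \<cdot> b) \<cdot> a = c \<cdot> (b \<cdot> a)"
    using cat unfolding is_category_def by (elim conjE)
  then show ?thesis
    using assms hom_objD[OF assms(1)] hom_objD[OF assms(3)] by blast
qed

lemma id_hom:
  assumes "x \<in> Obj C"
  shows "Id C x \<in> Hom C x x"
proof -
  have "\<forall>x\<in>Obj C. Id C x \<in> Hom C x x"
    using cat unfolding is_category_def by (elim conjE)
  then show ?thesis
    using assms by blast
qed

lemma comp_id:
  assumes "a \<in> Hom C x y"
  shows "a \<cdot> Id C x = a" "Id C y \<cdot> a = a"
proof -
  have "\<forall>x\<in>Obj C. \<forall>y\<in>Obj C. \<forall>a\<in>Hom C x y. a \<cdot> Id C x = a \<and> Id C y \<cdot> a = a"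
    using cat unfolding is_category_def by (elim conjE)
  then show "a \<cdot> Id C x = a" "Id C y \<cdot> a = a"
    using assms hom_objD[OF assms] by blast+
qed

end

lemma poset_cat_simps [simp]:
  "Obj (poset_cat P) = P" "Arr (poset_cat P) = {(x, y). x \<in> P \<and> y \<in> P \<and> x \<le> y}"
  "Dom (poset_cat P) = fst" "Cod (poset_cat P) = snd"
  "Id (poset_cat P) x = (x, x)" "Comp (poset_cat P) b a = (fst a, snd b)"
  by (simp_all add: poset_cat_def)

lemma in_Hom_poset_cat [simp]:
  "a \<in> Hom (poset_cat P) x y \<longleftrightarrow> a = (x, y) \<and> x \<in> P \<and> y \<in> P \<and> x \<le> y"
  by (cases a) (auto simp: Hom_def)

lemma ball_Hom_poset_cat:
  "(\<forall>a\<in>Hom (poset_cat P) x y. R a) \<longleftrightarrow> (x \<in> P \<longrightarrow> y \<in> P \<longrightarrow> x \<le> y \<longrightarrow> R (x, y))"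
  by auto

lemma poset_cat_is_category: "is_category (poset_cat P)"
  unfolding is_category_def ball_Hom_poset_cat by (intro conjI ballI impI) auto

lemma is_module_iff:
  "is_module P C M \<longleftrightarrow>
     (\<forall>x\<in>P. FObj M x \<in> Obj C) \<and>
     (\<forall>x\<in>P. \<forall>y\<in>P. x \<le> y \<longrightarrow> FArr M (x, y) \<in> Hom C (FObj M x) (FObj M y)) \<and>
     (\<forall>x\<in>P. FArr M (x, x) = Id C (FObj M x)) \<and>
     (\<forall>x\<in>P. \<forall>y\<in>P. \<forall>z\<in>P. x \<le> y \<longrightarrow> y \<le> z \<longrightarrow>
        FArr M (x, z) = FArr M (y, z) \<cdot>\<^bsub>C\<^esub> FArr M (x, y))"
  unfolding is_module_def is_functor_def ball_Hom_poset_cat poset_cat_simps fst_conv snd_conv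
  by (intro arg_cong2[where f = conj] ball_cong refl) simp_all

lemma is_module_hom_iff:
  "is_module_hom P C M N \<phi> \<longleftrightarrow>
     (\<forall>x\<in>P. \<phi> x \<in> Hom C (FObj M x) (FObj N x)) \<and>
     (\<forall>x\<in>P. \<forall>y\<in>P. x \<le> y \<longrightarrow> \<phi> y \<cdot>\<^bsub>C\<^esub> FArr M (x, y) = FArr N (x, y) \<cdot>\<^bsub>C\<^esub> \<phi> x)"
  unfolding is_nat_trans_def ball_Hom_poset_cat poset_cat_simps
  by (intro arg_cong2[where f = conj] ball_cong refl) simp_all

lemma module_obj: "is_module P C M \<Longrightarrow> x \<in> P \<Longrightarrow> FObj M x \<in> Obj C"
  by (simp add: is_module_iff)

lemma module_id: "is_module P C M \<Longrightarrow> x \<in> P \<Longrightarrow> FArr M (x, x) = Id C (FObj M x)"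
  by (simp add: is_module_iff)

lemma module_arr:
  assumes "is_module P C M" "x \<in> P" "y \<in> P" "x \<le> y"
  shows "FArr M (x, y) \<in> Hom C (FObj M x) (FObj M y)"
  using assms unfolding is_module_iff by blast

lemma module_comp:
  assumes "is_module P C M" "x \<in> P" "y \<in> P" "z \<in> P" "x \<le> y" "y \<le> z"
  shows "FArr M (y, z) \<cdot>\<^bsub>C\<^esub> FArr M (x, y) = FArr M (x, z)"
proof -
  have "\<forall>x\<in>P. \<forall>y\<in>P. \<forall>z\<in>P. x \<le> y \<longrightarrow> y \<le> z \<longrightarrow>
      FArr M (x, z) = FArr M (y, z) \<cdot>\<^bsub>C\<^esub> FArr M (x, y)"
    using assms(1) unfolding is_module_iff by (elim conjE)
  from this[rule_format, OF assms(2-6)] show ?thesis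
    by (rule sym)
qed

lemma module_subset:
  assumes M: "is_module P C M" and "P' \<subseteq> P"
  shows "is_module P' C M"
  unfolding is_module_iff
proof (intro conjI ballI impI)
  note inP = subsetD[OF assms(2)]
  show "FObj M x \<in> Obj C" if "x \<in> P'" for x
    by (rule module_obj[OF M inP[OF that]])
  show "FArr M (x, y) \<in> Hom C (FObj M x) (FObj M y)" if "x \<in> P'" "y \<in> P'" "x \<le> y" for x y
    using that by (intro module_arr[OF M] inP)
  show "FArr M (x, x) = Id C (FObj M x)" if "x \<in> P'" for x
    by (rule module_id[OF M inP[OF that]])
  show "FArr M (x, z) = FArr M (y, z) \<cdot>\<^bsub>C\<^esub> FArr M (x, y)"
    if "x \<in> P'" "y \<in> P'" "z \<in> P'" "x \<le> y" "y \<le> z" for x y z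
    using that by (intro module_comp[OF M, symmetric] inP)
qed

lemma module_hom_hom:
  assumes "is_module_hom P C M N \<phi>" "x \<in> P"
  shows "\<phi> x \<in> Hom C (FObj M x) (FObj N x)"
  using assms by (simp add: is_module_hom_iff)

lemma module_hom_natural:
  assumes "is_module_hom P C M N \<phi>" "x \<in> P" "y \<in> P" "x \<le> y"
  shows "\<phi> y \<cdot>\<^bsub>C\<^esub> FArr M (x, y) = FArr N (x, y) \<cdot>\<^bsub>C\<^esub> \<phi> x"
  using assms by (simp add: is_module_hom_iff)

lemma pullback_simps [simp]:
  "FObj (pullback f M) p = FObj M (f p)" "FArr (pullback f M) (x, y) = FArr M (f x, f y)"
  by (simp_all add: pullback_def)

lemma shiftQ_simps [simp]:
  "FObj (shiftQ T \<epsilon> M) q = FObj M (T \<epsilon> q)"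
  "FArr (shiftQ T \<epsilon> M) (x, y) = FArr M (T \<epsilon> x, T \<epsilon> y)"
  by (simp_all add: shiftQ_def)

lemma poset_map_in: "poset_map P Q f \<Longrightarrow> p \<in> P \<Longrightarrow> f p \<in> Q"
  by (auto simp: poset_map_def)

lemma poset_map_mono: "poset_map P Q f \<Longrightarrow> x \<in> P \<Longrightarrow> y \<in> P \<Longrightarrow> x \<le> y \<Longrightarrow> f x \<le> f y"
  by (auto simp: poset_map_def mono_on_def)

lemma pullback_module:
  assumes f: "poset_map P Q f" and M: "is_module Q C M"
  shows "is_module P C (pullback f M)"
  unfolding is_module_iff pullback_simps
proof (intro conjI ballI impI)
  note fin = poset_map_in[OF f] and mono = poset_map_mono[OF f]
  show "FObj M (f x) \<in> Obj C" if "x \<in> P" for x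
    by (rule module_obj[OF M fin[OF that]])
  show "FArr M (f x, f y) \<in> Hom C (FObj M (f x)) (FObj M (f y))" if "x \<in> P" "y \<in> P" "x \<le> y" for x y
    using that by (intro module_arr[OF M] fin mono)
  show "FArr M (f x, f x) = Id C (FObj M (f x))" if "x \<in> P" for x
    by (rule module_id[OF M fin[OF that]])
  show "FArr M (f x, f z) = FArr M (f y, f z) \<cdot>\<^bsub>C\<^esub> FArr M (f x, f y)"
    if "x \<in> P" "y \<in> P" "z \<in> P" "x \<le> y" "y \<le> z" for x y z
    using that by (intro module_comp[OF M, symmetric] fin mono)
qed

section \<open>The interleaving distance over a poset with translations\<close>

text \<open>One half of the interleaving condition. Its right-hand side is the single internal map
  \<open>q \<le> T\<^bsub>2\<epsilon>\<^esub> q\<close>, to which the composite of \<open>\<eta>\<^sup>0\<close> and \<open>\<eta>\<^bsup>0,2\<epsilon>\<^esup>\<close> reduces by functoriality.\<close>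

definition composes_to_internal ::
  "'q::order set \<Rightarrow> (real \<Rightarrow> 'q \<Rightarrow> 'q) \<Rightarrow> ('o, 'a) category \<Rightarrow> real
    \<Rightarrow> ('q, 'o, 'a) pmodule \<Rightarrow> ('q \<Rightarrow> 'a) \<Rightarrow> ('q \<Rightarrow> 'a) \<Rightarrow> bool" where
  "composes_to_internal Q T C \<epsilon> M \<phi> \<psi> \<longleftrightarrow>
     (\<forall>q\<in>Q. FArr M (T \<epsilon> (T \<epsilon> q), T (2 * \<epsilon>) q) \<cdot>\<^bsub>C\<^esub> (\<psi> (T \<epsilon> q) \<cdot>\<^bsub>C\<^esub> \<phi> q)
           = FArr M (q, T (2 * \<epsilon>) q))"

locale translated_poset = lawful_category C
  for C :: "('o, 'a) category" (structure) +
  fixes Q :: "'q::order set" and T :: "real \<Rightarrow> 'q \<Rightarrow> 'q"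
  assumes superlinear: "superlinear_family Q T"
begin

lemma translation_map: "0 \<le> \<epsilon> \<Longrightarrow> poset_map Q Q (T \<epsilon>)"
  using superlinear by (simp add: superlinear_family_def translation_def)

lemma T_in: "0 \<le> \<epsilon> \<Longrightarrow> q \<in> Q \<Longrightarrow> T \<epsilon> q \<in> Q"
  using translation_map poset_map_in by fast

lemma T_mono: "0 \<le> \<epsilon> \<Longrightarrow> x \<in> Q \<Longrightarrow> y \<in> Q \<Longrightarrow> x \<le> y \<Longrightarrow> T \<epsilon> x \<le> T \<epsilon> y"
  using translation_map poset_map_mono by fast

lemma T_ge: "0 \<le> \<epsilon> \<Longrightarrow> q \<in> Q \<Longrightarrow> q \<le> T \<epsilon> q"
  using superlinear by (simp add: superlinear_family_def translation_def)

lemma T_superlinear: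
  assumes "0 \<le> \<epsilon>1" "0 \<le> \<epsilon>2" "q \<in> Q" "\<epsilon>1 + \<epsilon>2 = \<epsilon>"
  shows "T \<epsilon>2 (T \<epsilon>1 q) \<le> T \<epsilon> q"
  using superlinear assms by (auto simp: superlinear_family_def)

lemma T_param_mono:
  assumes "0 \<le> \<epsilon>" "\<epsilon> \<le> \<epsilon>'" "q \<in> Q"
  shows "T \<epsilon> q \<le> T \<epsilon>' q"
proof -
  have "T \<epsilon> q \<le> T (\<epsilon>' - \<epsilon>) (T \<epsilon> q)"
    using assms by (intro T_ge T_in) auto
  also have "\<dots> \<le> T \<epsilon>' q"
    using assms by (intro T_superlinear) auto
  finally show ?thesis .
qed

lemma shiftQ_module: "0 \<le> \<epsilon> \<Longrightarrow> is_module Q C M \<Longrightarrow> is_module Q C (shiftQ T \<epsilon> M)"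
  unfolding shiftQ_def using pullback_module translation_map by blast

lemma weak_interleavingQ_iff:
  assumes "0 \<le> \<epsilon>" "is_module Q C M" "is_module Q C N"
  shows "weak_interleavingQ Q T C \<epsilon> M N \<phi> \<psi> \<longleftrightarrow>
     is_module_hom Q C M (shiftQ T \<epsilon> N) \<phi> \<and> is_module_hom Q C N (shiftQ T \<epsilon> M) \<psi> \<and>
     composes_to_internal Q T C \<epsilon> M \<phi> \<psi> \<and> composes_to_internal Q T C \<epsilon> N \<psi> \<phi>"
proof -
  have *: "FArr X (T 0 q, T (2 * \<epsilon>) q) \<cdot> FArr X (q, T 0 q) = FArr X (q, T (2 * \<epsilon>) q)"
    if "is_module Q C X" "q \<in> Q" for X q
    using that assms(1) by (intro module_comp) (auto intro!: T_in T_ge T_param_mono)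
  show ?thesis
    using *[OF assms(2)] *[OF assms(3)]
    by (simp add: weak_interleavingQ_def composes_to_internal_def nt_comp_def SigmaQ_def
        shiftQ_hom_def pullback_hom_def etaQ_def etaQ2_def)
qed

lemma distQ_commute: "distQ Q T C M N = distQ Q T C N M"
proof -
  have "weak_interleavingQ Q T C \<epsilon> M N \<phi> \<psi> \<longleftrightarrow> weak_interleavingQ Q T C \<epsilon> N M \<psi> \<phi>" for \<epsilon> \<phi> \<psi>
    by (auto simp: weak_interleavingQ_def)
  then show ?thesis
    unfolding distQ_def by metis
qed

text \<open>The plain composite of maps \<open>M \<rightarrow> T\<^sub>a\<^sup>* N\<close> and \<open>N \<rightarrow> T\<^sub>b\<^sup>* L\<close> ends in \<open>L\<close> at \<open>T\<^sub>b T\<^sub>a q\<close>; since the family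
  is only superlinear, an internal map of the target is needed to reach \<open>L\<close> at \<open>T\<^bsub>a+b\<^esub> q\<close>.\<close>

definition shifted_comp ::
  "real \<Rightarrow> real \<Rightarrow> ('q, 'o, 'a) pmodule \<Rightarrow> ('q \<Rightarrow> 'a) \<Rightarrow> ('q \<Rightarrow> 'a) \<Rightarrow> 'q \<Rightarrow> 'a" where
  "shifted_comp a b L \<phi>' \<phi> =
     (\<lambda>q. FArr L (T b (T a q), T (a + b) q) \<cdot> (\<phi>' (T a q) \<cdot> \<phi> q))"

lemma shifted_comp_module_hom:
  assumes "0 \<le> a" "0 \<le> b"
    and "is_module Q C L"
    and "is_module Q C M"
    and "is_module Q C N"
    and \<phi>: "is_module_hom Q C M (shiftQ T a N) \<phi>"
    and \<phi>': "is_module_hom Q C N (shiftQ T b L) \<phi>'"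
  shows "is_module_hom Q C M (shiftQ T (a + b) L) (shifted_comp a b L \<phi>' \<phi>)"
  unfolding is_module_hom_iff
proof (intro conjI ballI impI)
  note le = T_in T_mono T_superlinear assms(1,2) add_nonneg_nonneg[OF assms(1,2)]
  have \<phi>_hom: "\<phi> q \<in> Hom C (FObj M q) (FObj N (T a q))" if "q \<in> Q" for q
    using module_hom_hom[OF \<phi> that] by simp
  have \<phi>'_hom: "\<phi>' (T a q) \<in> Hom C (FObj N (T a q)) (FObj L (T b (T a q)))" if "q \<in> Q" for q
    using module_hom_hom[OF \<phi>', of "T a q"] that le by simp
  have L_hom: "FArr L (T b (T a q), T (a + b) q) \<in> Hom C (FObj L (T b (T a q))) (FObj L (T (a + b) q))"
    if "q \<in> Q" for q
    using that by (intro module_arr[OF assms(3)]) (auto intro!: le)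
  show "shifted_comp a b L \<phi>' \<phi> q \<in> Hom C (FObj M q) (FObj (shiftQ T (a + b) L) q)" if "q \<in> Q" for q
    unfolding shifted_comp_def using comp_hom[OF comp_hom[OF \<phi>_hom \<phi>'_hom] L_hom] that by simp
  fix x y assume xy: "x \<in> Q" "y \<in> Q" "x \<le> y"
  have M_xy: "FArr M (x, y) \<in> Hom C (FObj M x) (FObj M y)"
    by (intro module_arr[OF assms(4)] xy)
  have N_xy: "FArr N (T a x, T a y) \<in> Hom C (FObj N (T a x)) (FObj N (T a y))"
    by (intro module_arr[OF assms(5)]) (auto intro!: le xy)
  have L_xy: "FArr L (T b (T a x), T b (T a y)) \<in> Hom C (FObj L (T b (T a x))) (FObj L (T b (T a y)))"
    by (intro module_arr[OF assms(3)]) (auto intro!: le xy)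
  have L_xy': "FArr L (T (a + b) x, T (a + b) y) \<in> Hom C (FObj L (T (a + b) x)) (FObj L (T (a + b) y))"
    using assms(1,2) by (intro module_arr[OF assms(3)]) (auto intro!: T_in T_mono xy)
  have "shifted_comp a b L \<phi>' \<phi> y \<cdot> FArr M (x, y)
      = FArr L (T b (T a y), T (a + b) y) \<cdot> (\<phi>' (T a y) \<cdot> (\<phi> y \<cdot> FArr M (x, y)))"
    unfolding shifted_comp_def
    using comp_assoc[OF M_xy comp_hom[OF \<phi>_hom \<phi>'_hom] L_hom] comp_assoc[OF M_xy \<phi>_hom \<phi>'_hom] xy
    by simp
  also have "\<dots> = FArr L (T b (T a y), T (a + b) y) \<cdot> (\<phi>' (T a y) \<cdot> (FArr N (T a x, T a y) \<cdot> \<phi> x))"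
    using module_hom_natural[OF \<phi> xy] by simp
  also have "\<dots> = FArr L (T b (T a y), T (a + b) y) \<cdot> ((\<phi>' (T a y) \<cdot> FArr N (T a x, T a y)) \<cdot> \<phi> x)"
    using comp_assoc[OF \<phi>_hom N_xy \<phi>'_hom] xy by simp
  also have "\<dots> = FArr L (T b (T a y), T (a + b) y) \<cdot> ((FArr L (T b (T a x), T b (T a y)) \<cdot> \<phi>' (T a x)) \<cdot> \<phi> x)"
    using module_hom_natural[OF \<phi>', of "T a x" "T a y"] xy le by simp
  also have "\<dots> = (FArr L (T b (T a y), T (a + b) y) \<cdot> FArr L (T b (T a x), T b (T a y))) \<cdot> (\<phi>' (T a x) \<cdot> \<phi> x)"
    using comp_assoc[OF comp_hom[OF \<phi>_hom \<phi>'_hom] L_xy L_hom] comp_assoc[OF \<phi>_hom \<phi>'_hom L_xy] xy by simp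
  also have "FArr L (T b (T a y), T (a + b) y) \<cdot> FArr L (T b (T a x), T b (T a y))
      = FArr L (T b (T a x), T (a + b) y)"
    by (intro module_comp[OF assms(3)]) (auto intro!: le xy)
  also have "\<dots> = FArr L (T (a + b) x, T (a + b) y) \<cdot> FArr L (T b (T a x), T (a + b) x)"
    by (intro module_comp[OF assms(3), symmetric]) (auto intro!: le xy)
  also have "\<dots> \<cdot> (\<phi>' (T a x) \<cdot> \<phi> x) = FArr L (T (a + b) x, T (a + b) y) \<cdot> shifted_comp a b L \<phi>' \<phi> x"
    unfolding shifted_comp_def using comp_assoc[OF comp_hom[OF \<phi>_hom \<phi>'_hom] L_hom L_xy'] xy by simp
  finally show "shifted_comp a b L \<phi>' \<phi> y \<cdot> FArr M (x, y)
      = FArr (shiftQ T (a + b) L) (x, y) \<cdot> shifted_comp a b L \<phi>' \<phi> x"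
    by simp
qed

text \<open>To cancel \<open>\<psi>' \<circ> \<phi>'\<close>, it must be brought next to the internal map of \<open>N\<close> from
  \<open>T\<^sub>b T\<^sub>b T\<^sub>a q\<close> to \<open>T\<^bsub>2b\<^esub> T\<^sub>a q\<close>. Naturality of \<open>\<psi>'\<close> only produces the internal map to \<open>T\<^sub>b T\<^bsub>a+b\<^esub> q\<close>, which need not
  be comparable with \<open>T\<^bsub>2b\<^esub> T\<^sub>a q\<close>. Both lie below \<open>T\<^bsub>a+2b\<^esub> q\<close>, however, and there is room to move \<open>\<psi>\<close>
  up to that point, as \<open>T\<^sub>a T\<^bsub>a+2b\<^esub> q \<le> T\<^bsub>2(a+b)\<^esub> q\<close>. After \<open>\<psi>' \<circ> \<phi>'\<close> has collapsed, \<open>\<psi>\<close> is moved down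
  to \<open>T\<^sub>a q\<close>, where \<open>\<psi> \<circ> \<phi>\<close> collapses.\<close>

lemma shifted_comp_composes_to_internal:
  assumes ab: "0 \<le> a" "0 \<le> b"
    and L: "is_module Q C L"
    and M: "is_module Q C M"
    and N: "is_module Q C N"
    and \<phi>: "is_module_hom Q C M (shiftQ T a N) \<phi>"
    and \<psi>: "is_module_hom Q C N (shiftQ T a M) \<psi>"
    and \<phi>': "is_module_hom Q C N (shiftQ T b L) \<phi>'"
    and \<psi>': "is_module_hom Q C L (shiftQ T b N) \<psi>'"
    and \<psi>\<phi>: "composes_to_internal Q T C a M \<phi> \<psi>"
    and \<psi>'\<phi>': "composes_to_internal Q T C b N \<phi>' \<psi>'"
  shows "composes_to_internal Q T C (a + b) M (shifted_comp a b L \<phi>' \<phi>) (shifted_comp b a M \<psi> \<psi>')"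
  unfolding composes_to_internal_def
proof
  fix q assume q: "q \<in> Q"
  define s where "s = T (a + b) q"
  define u where "u = T a q"
  define v where "v = T b u"
  \<comment> \<open>the common upper bound of \<open>T\<^sub>b T\<^bsub>a+b\<^esub> q\<close> and \<open>T\<^bsub>2b\<^esub> T\<^sub>a q\<close> at which \<open>\<psi>\<close> is evaluated\<close>
  define r where "r = T (a + 2 * b) q"
  define t where "t = T (2 * (a + b)) q"
  have inQ: "s \<in> Q" "u \<in> Q" "v \<in> Q" "r \<in> Q" "t \<in> Q" "T b s \<in> Q" "T b v \<in> Q" "T (2 * b) u \<in> Q" "T a u \<in> Q" "T a r \<in> Q"
     "T a (T b s) \<in> Q" "T (a + b) s \<in> Q" "T (2 * a) q \<in> Q"
    using q ab by (auto simp: s_def u_def v_def r_def t_def intro!: T_in)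
  have vs: "v \<le> s"
    unfolding s_def u_def v_def using q ab by (intro T_superlinear) auto
  have sr: "T b s \<le> r"
    unfolding s_def r_def using q ab by (intro T_superlinear) auto
  have bv_bs: "T b v \<le> T b s"
    using vs ab inQ by (intro T_mono) auto
  have bv_2b: "T b v \<le> T (2 * b) u"
    unfolding v_def using ab inQ by (intro T_superlinear) auto
  have tr: "T (2 * b) u \<le> r"
    unfolding u_def r_def using q ab by (intro T_superlinear) auto
  have u2: "u \<le> T (2 * b) u"
    using ab inQ by (intro T_ge) auto
  have ur: "u \<le> r" 
    using u2 tr by simp
  have abs: "T a (T b s) \<le> T (a + b) s"
    using ab inQ by (intro T_superlinear) auto
  have st: "T (a + b) s \<le> t"
    unfolding s_def t_def using q ab by (intro T_superlinear) auto
  have abs_ar: "T a (T b s) \<le> T a r"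
    using ab inQ sr by (intro T_mono) auto
  have art: "T a r \<le> t"
    unfolding r_def t_def using q ab by (intro T_superlinear) auto
  have au_ar: "T a u \<le> T a r"
    using ab inQ ur by (intro T_mono) auto
  have au: "T a u \<le> T (2 * a) q"
    unfolding u_def using q ab by (intro T_superlinear) auto
  have t2a: "T (2 * a) q \<le> t"
    unfolding t_def using q ab by (intro T_param_mono) auto
  have q2a: "q \<le> T (2 * a) q"
    using q ab by (intro T_ge) auto
  have \<phi>q: "\<phi> q \<in> Hom C (FObj M q) (FObj N u)"
    using module_hom_hom[OF \<phi> q] by (simp add: u_def)
  have \<phi>'u: "\<phi>' u \<in> Hom C (FObj N u) (FObj L v)"
    using module_hom_hom[OF \<phi>', of u] inQ by (simp add: v_def)
  have \<psi>'v: "\<psi>' v \<in> Hom C (FObj L v) (FObj N (T b v))"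
    using module_hom_hom[OF \<psi>', of v] inQ by simp
  have \<psi>'s: "\<psi>' s \<in> Hom C (FObj L s) (FObj N (T b s))"
    using module_hom_hom[OF \<psi>', of s] inQ by simp
  have \<psi>_hom: "\<psi> x \<in> Hom C (FObj N x) (FObj M (T a x))" if "x \<in> Q" for x
    using module_hom_hom[OF \<psi>, of x] that by simp
  note Lvs = module_arr[OF L inQ(3,1) vs]
  have \<phi>'\<phi>: "\<phi>' u \<cdot> \<phi> q \<in> Hom C (FObj M q) (FObj L v)"
    by (rule comp_hom[OF \<phi>q \<phi>'u])
  have \<psi>'\<phi>'\<phi>: "\<psi>' v \<cdot> (\<phi>' u \<cdot> \<phi> q) \<in> Hom C (FObj M q) (FObj N (T b v))"
    by (rule comp_hom[OF \<phi>'\<phi> \<psi>'v])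
  define \<alpha> where "\<alpha> = FArr L (v, s) \<cdot> (\<phi>' u \<cdot> \<phi> q)"
  have \<alpha>: "\<alpha> \<in> Hom C (FObj M q) (FObj L s)"
    unfolding \<alpha>_def by (rule comp_hom[OF \<phi>'\<phi> Lvs])
  have \<psi>'\<alpha>: "\<psi>' s \<cdot> \<alpha> \<in> Hom C (FObj M q) (FObj N (T b s))"
    by (rule comp_hom[OF \<alpha> \<psi>'s])
  note Nbs_r = module_arr[OF N inQ(6,4) sr]
  have N_part: "FArr N (T b s, r) \<cdot> (\<psi>' s \<cdot> \<alpha>) = FArr N (u, r) \<cdot> \<phi> q"
  proof -
    have "\<psi>' s \<cdot> \<alpha> = (\<psi>' s \<cdot> FArr L (v, s)) \<cdot> (\<phi>' u \<cdot> \<phi> q)"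
      unfolding \<alpha>_def using comp_assoc[OF \<phi>'\<phi> Lvs \<psi>'s] by simp
    also have "\<dots> = FArr N (T b v, T b s) \<cdot> (\<psi>' v \<cdot> (\<phi>' u \<cdot> \<phi> q))"
      using module_hom_natural[OF \<psi>' inQ(3,1) vs]
        comp_assoc[OF \<phi>'\<phi> \<psi>'v module_arr[OF N inQ(7,6) bv_bs]] by simp
    finally have "FArr N (T b s, r) \<cdot> (\<psi>' s \<cdot> \<alpha>)
        = FArr N (T b v, r) \<cdot> (\<psi>' v \<cdot> (\<phi>' u \<cdot> \<phi> q))"
      using comp_assoc[OF \<psi>'\<phi>'\<phi> module_arr[OF N inQ(7,6) bv_bs] Nbs_r]
        module_comp[OF N inQ(7,6,4) bv_bs sr] by simp
    also have "\<dots> = FArr N (T (2 * b) u, r) \<cdot> (FArr N (T b v, T (2 * b) u) \<cdot> (\<psi>' v \<cdot> (\<phi>' u \<cdot> \<phi> q)))"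
      using comp_assoc[OF \<psi>'\<phi>'\<phi> module_arr[OF N inQ(7,8) bv_2b] module_arr[OF N inQ(8,4) tr]]
        module_comp[OF N inQ(7,8,4) bv_2b tr] by simp
    also have "FArr N (T b v, T (2 * b) u) \<cdot> (\<psi>' v \<cdot> (\<phi>' u \<cdot> \<phi> q))
        = (FArr N (T b v, T (2 * b) u) \<cdot> (\<psi>' v \<cdot> \<phi>' u)) \<cdot> \<phi> q"
      using comp_assoc[OF \<phi>q comp_hom[OF \<phi>'u \<psi>'v] module_arr[OF N inQ(7,8) bv_2b]]
        comp_assoc[OF \<phi>q \<phi>'u \<psi>'v] by simp
    also have "FArr N (T b v, T (2 * b) u) \<cdot> (\<psi>' v \<cdot> \<phi>' u) = FArr N (u, T (2 * b) u)"
      using \<psi>'\<phi>' inQ(2) by (simp add: composes_to_internal_def v_def)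
    also have "FArr N (T (2 * b) u, r) \<cdot> (FArr N (u, T (2 * b) u) \<cdot> \<phi> q) = FArr N (u, r) \<cdot> \<phi> q"
      using comp_assoc[OF \<phi>q module_arr[OF N inQ(2,8) u2] module_arr[OF N inQ(8,4) tr]]
        module_comp[OF N inQ(2,8,4) u2 tr] by simp
    finally show ?thesis .
  qed
  have "FArr M (T (a + b) s, t) \<cdot> (shifted_comp b a M \<psi> \<psi>' s \<cdot> \<alpha>)
      = FArr M (T (a + b) s, t) \<cdot> (FArr M (T a (T b s), T (a + b) s) \<cdot> (\<psi> (T b s) \<cdot> (\<psi>' s \<cdot> \<alpha>)))"
    unfolding shifted_comp_def
    using comp_assoc[OF \<alpha> comp_hom[OF \<psi>'s \<psi>_hom] module_arr[OF M inQ(11,12) abs]]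
      comp_assoc[OF \<alpha> \<psi>'s \<psi>_hom] inQ by (simp add: add.commute)
  also have "\<dots> = FArr M (T a (T b s), t) \<cdot> (\<psi> (T b s) \<cdot> (\<psi>' s \<cdot> \<alpha>))"
    using comp_assoc[OF comp_hom[OF \<psi>'\<alpha> \<psi>_hom[OF inQ(6)]] module_arr[OF M inQ(11,12) abs]
        module_arr[OF M inQ(12,5) st]] module_comp[OF M inQ(11,12,5) abs st] by simp
  \<comment> \<open>naturality moves \<open>\<psi>\<close> up from \<open>T\<^sub>b s\<close> to \<open>r\<close>\<close>
  also have "\<dots> = FArr M (T a r, t) \<cdot> (FArr M (T a (T b s), T a r) \<cdot> (\<psi> (T b s) \<cdot> (\<psi>' s \<cdot> \<alpha>)))"
    using comp_assoc[OF comp_hom[OF \<psi>'\<alpha> \<psi>_hom[OF inQ(6)]] module_arr[OF M inQ(11,10) abs_ar]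
        module_arr[OF M inQ(10,5) art]] module_comp[OF M inQ(11,10,5) abs_ar art] by simp
  also have "FArr M (T a (T b s), T a r) \<cdot> (\<psi> (T b s) \<cdot> (\<psi>' s \<cdot> \<alpha>))
      = \<psi> r \<cdot> (FArr N (T b s, r) \<cdot> (\<psi>' s \<cdot> \<alpha>))"
    using comp_assoc[OF \<psi>'\<alpha> \<psi>_hom[OF inQ(6)] module_arr[OF M inQ(11,10) abs_ar]]
      module_hom_natural[OF \<psi> inQ(6,4) sr] comp_assoc[OF \<psi>'\<alpha> Nbs_r \<psi>_hom[OF inQ(4)]] by simp
  also have "\<dots> = \<psi> r \<cdot> (FArr N (u, r) \<cdot> \<phi> q)"
    by (simp add: N_part)
  \<comment> \<open>naturality moves \<open>\<psi>\<close> down from \<open>r\<close> to \<open>u\<close>\<close>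
  also have "\<dots> = FArr M (T a u, T a r) \<cdot> (\<psi> u \<cdot> \<phi> q)"
    using comp_assoc[OF \<phi>q module_arr[OF N inQ(2,4) ur] \<psi>_hom[OF inQ(4)]]
      module_hom_natural[OF \<psi> inQ(2,4) ur]
      comp_assoc[OF \<phi>q \<psi>_hom[OF inQ(2)] module_arr[OF M inQ(9,10) au_ar]] by simp
  also have "FArr M (T a r, t) \<cdot> (FArr M (T a u, T a r) \<cdot> (\<psi> u \<cdot> \<phi> q))
      = FArr M (T a u, t) \<cdot> (\<psi> u \<cdot> \<phi> q)"
    using comp_assoc[OF comp_hom[OF \<phi>q \<psi>_hom[OF inQ(2)]] module_arr[OF M inQ(9,10) au_ar]
        module_arr[OF M inQ(10,5) art]] module_comp[OF M inQ(9,10,5) au_ar art] by simp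
  also have "\<dots> = FArr M (T (2 * a) q, t) \<cdot> (FArr M (T a u, T (2 * a) q) \<cdot> (\<psi> u \<cdot> \<phi> q))"
    using comp_assoc[OF comp_hom[OF \<phi>q \<psi>_hom[OF inQ(2)]] module_arr[OF M inQ(9,13) au]
        module_arr[OF M inQ(13,5) t2a]] module_comp[OF M inQ(9,13,5) au t2a] by simp
  also have "FArr M (T a u, T (2 * a) q) \<cdot> (\<psi> u \<cdot> \<phi> q) = FArr M (q, T (2 * a) q)"
    using \<psi>\<phi> q by (simp add: composes_to_internal_def u_def)
  also have "FArr M (T (2 * a) q, t) \<cdot> FArr M (q, T (2 * a) q) = FArr M (q, t)"
    by (rule module_comp[OF M q inQ(13,5) q2a t2a])
  finally show "FArr M (T (a + b) (T (a + b) q), T (2 * (a + b)) q) \<cdot>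
      (shifted_comp b a M \<psi> \<psi>' (T (a + b) q) \<cdot> shifted_comp a b L \<phi>' \<phi> q) = FArr M (q, T (2 * (a + b)) q)"
    by (simp add: \<alpha>_def s_def t_def u_def v_def shifted_comp_def[of a b])
qed

lemma weak_interleavingQ_trans:
  assumes ab: "0 \<le> a" "0 \<le> b"
    and mods: "is_module Q C L" "is_module Q C M" "is_module Q C N"
    and MN: "weak_interleavingQ Q T C a M N \<phi> \<psi>"
    and NL: "weak_interleavingQ Q T C b N L \<phi>' \<psi>'"
  shows "weak_interleavingQ Q T C (a + b) M L (shifted_comp a b L \<phi>' \<phi>) (shifted_comp b a M \<psi> \<psi>')"
proof -
  note 1 = MN[unfolded weak_interleavingQ_iff[OF ab(1) mods(2,3)]]
  note 2 = NL[unfolded weak_interleavingQ_iff[OF ab(2) mods(3,1)]]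
  have "is_module_hom Q C M (shiftQ T (a + b) L) (shifted_comp a b L \<phi>' \<phi>)"
    using shifted_comp_module_hom[of a b L M N \<phi> \<phi>'] ab mods 1 2 by blast
  moreover have "is_module_hom Q C L (shiftQ T (a + b) M) (shifted_comp b a M \<psi> \<psi>')"
    using shifted_comp_module_hom[of b a M L N \<psi>' \<psi>] ab mods 1 2 by (simp add: add.commute)
  moreover have "composes_to_internal Q T C (a + b) M (shifted_comp a b L \<phi>' \<phi>) (shifted_comp b a M \<psi> \<psi>')"
    using shifted_comp_composes_to_internal[of a b L M N \<phi> \<psi> \<phi>' \<psi>'] ab mods 1 2 by blast
  moreover have "composes_to_internal Q T C (a + b) L (shifted_comp b a M \<psi> \<psi>') (shifted_comp a b L \<phi>' \<phi>)"
    using shifted_comp_composes_to_internal[of b a M L N \<psi>' \<phi>' \<psi> \<phi>] ab mods 1 2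
    by (simp add: add.commute)
  ultimately show ?thesis
    using weak_interleavingQ_iff ab mods by simp
qed

end

lemma le_Inf_add_Inf_ennreal:
  fixes x :: ennreal
  assumes "\<And>a b. a \<in> A \<Longrightarrow> b \<in> B \<Longrightarrow> x \<le> a + b"
  shows "x \<le> Inf A + Inf B"
proof -
  have *: "x \<le> a + Inf Y" if "\<And>y. y \<in> Y \<Longrightarrow> x \<le> a + y" for a and Y :: "ennreal set"
  proof (cases "a = top")
    case False
    have "x - a \<le> Inf Y"
    proof (rule Inf_greatest)
      fix y assume "y \<in> Y"
      then show "x - a \<le> y"
        using that False by (simp add: ennreal_minus_le_iff)
    qed
    then show ?thesis
      using False unfolding ennreal_minus_le_iff by simp
  qed simp
  have "x \<le> Inf B + a" if "a \<in> A" for a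
    using *[of B a] assms[OF that] by (simp add: add.commute)
  then have "x \<le> Inf B + Inf A"
    by (rule *)
  then show ?thesis
    by (simp add: add.commute)
qed

lemma (in translated_poset) distQ_triangle:
  assumes mods: "is_module Q C L" "is_module Q C M" "is_module Q C N"
  shows "distQ Q T C M L \<le> distQ Q T C M N + distQ Q T C N L"
  unfolding distQ_def[of Q T C M N] distQ_def[of Q T C N L]
proof (rule le_Inf_add_Inf_ennreal, clarify)
  fix a b :: real and \<phi> \<psi> \<phi>' \<psi>'
  assume *: "0 \<le> a" "weak_interleavingQ Q T C a M N \<phi> \<psi>"
    "0 \<le> b" "weak_interleavingQ Q T C b N L \<phi>' \<psi>'"
  have "ennreal (a + b) \<in> {ennreal \<epsilon> |\<epsilon>. 0 \<le> \<epsilon> \<and> (\<exists>\<phi> \<psi>. weak_interleavingQ Q T C \<epsilon> M L \<phi> \<psi>)}"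
    using weak_interleavingQ_trans[OF *(1,3) mods *(2,4)] *(1,3) add_nonneg_nonneg by blast
  then have "distQ Q T C M L \<le> ennreal (a + b)"
    unfolding distQ_def by (rule Inf_lower)
  then show "distQ Q T C M L \<le> ennreal a + ennreal b"
    using * by simp
qed

section \<open>Pushforward as a left adjoint\<close>

lemma colimit_ex1:
  assumes "is_colimit J C D c \<iota>" "is_cocone J C D d \<kappa>"
  shows "\<exists>!h. h \<in> Hom C c d \<and> (\<forall>x\<in>Obj J. h \<cdot>\<^bsub>C\<^esub> \<iota> x = \<kappa> x)"
  by (rule assms(1)[unfolded is_colimit_def, THEN conjunct2, THEN spec, THEN spec, THEN mp, OF assms(2)])

lemma colim_desc:
  assumes "is_colimit J C D (colim J C D) (coproj J C D)" "is_cocone J C D d \<kappa>"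
  shows "colim_desc J C D d \<kappa> \<in> Hom C (colim J C D) d"
    and "x \<in> Obj J \<Longrightarrow> colim_desc J C D d \<kappa> \<cdot>\<^bsub>C\<^esub> coproj J C D x = \<kappa> x"
  using theI'[OF colimit_ex1[OF assms]] unfolding colim_desc_def by simp_all

lemma colimit_arr_eqI:
  assumes "is_colimit J C D c \<iota>" "is_cocone J C D d \<kappa>"
    and "h \<in> Hom C c d" "\<And>x. x \<in> Obj J \<Longrightarrow> h \<cdot>\<^bsub>C\<^esub> \<iota> x = \<kappa> x"
    and "h' \<in> Hom C c d" "\<And>x. x \<in> Obj J \<Longrightarrow> h' \<cdot>\<^bsub>C\<^esub> \<iota> x = \<kappa> x"
  shows "h = h'"
proof -
  have *: "a = b" if "\<exists>!x. R x" "R a" "R b" for R a b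
    using that by blast
  show ?thesis
    by (rule *[OF colimit_ex1[OF assms(1,2)]]) (use assms(3-6) in simp_all)
qed

locale cocomplete_poset_map = lawful_category C
  for C :: "('o, 'a) category" (structure) +
  fixes P :: "'p::order set" and Q :: "'q::order set" and f :: "'p \<Rightarrow> 'q"
  assumes f: "poset_map P Q f"
    and cocomplete: "cocomplete TYPE('p) TYPE('p \<times> 'p) C"
begin

abbreviation "push \<equiv> pushforward P f C"
abbreviation "\<iota> A q \<equiv> coproj (below P f q) C A"

lemma below_colimit:
  assumes "is_module P C A"
  shows "is_colimit (below P f q) C A (colim (below P f q) C A) (\<iota> A q)"
proof -
  have "is_module {p \<in> P. f p \<le> q} C A"
    by (rule module_subset[OF assms]) blast
  then have "is_functor (below P f q) C A"
    by (simp add: below_def is_module_def)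
  moreover have "is_category (below P f q)"
    unfolding below_def by (rule poset_cat_is_category)
  ultimately obtain c \<kappa> where "is_colimit (below P f q) C A c \<kappa>"
    using cocomplete unfolding cocomplete_def by metis
  then have "\<exists>L. is_colimit (below P f q) C A (fst L) (snd L)"
    by (intro exI[of _ "(c, \<kappa>)"]) simp
  from someI_ex[OF this] show ?thesis
    by (simp add: colim_def coproj_def some_colimit_def)
qed

lemma below_cocone:
  assumes "is_module P C A"
  shows "is_cocone (below P f q) C A (FObj (push A) q) (\<iota> A q)"
  using below_colimit[OF assms] unfolding is_colimit_def pushforward_def by simp

lemma coproj_hom:
  assumes "is_module P C A" "p \<in> P" "f p \<le> q"
  shows "\<iota> A q p \<in> Hom C (FObj A p) (FObj (push A) q)"
  using below_cocone[OF assms(1), of q] assms(2,3) unfolding is_cocone_def below_def by simp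

lemma coproj_natural:
  assumes "is_module P C A" "x \<in> P" "y \<in> P" "x \<le> y" "f y \<le> q"
  shows "\<iota> A q y \<cdot> FArr A (x, y) = \<iota> A q x"
proof -
  have "f x \<le> q"
    using poset_map_mono[OF f assms(2-4)] assms(5) by simp
  then show ?thesis
    using below_cocone[OF assms(1), of q] assms(2-5) unfolding is_cocone_def below_def by simp
qed

lemma push_obj: "is_module P C A \<Longrightarrow> FObj (push A) q \<in> Obj C"
  using below_cocone[of A q] unfolding is_cocone_def by simp

lemma below_desc:
  assumes A: "is_module P C A" and d: "d \<in> Obj C"
    and \<kappa>: "\<And>p. p \<in> P \<Longrightarrow> f p \<le> q \<Longrightarrow> \<kappa> p \<in> Hom C (FObj A p) d"
    and nat: "\<And>x y. x \<in> P \<Longrightarrow> y \<in> P \<Longrightarrow> x \<le> y \<Longrightarrow> f x \<le> q \<Longrightarrow> f y \<le> q \<Longrightarrow> \<kappa> y \<cdot> FArr A (x, y) = \<kappa> x"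
  shows "colim_desc (below P f q) C A d \<kappa> \<in> Hom C (FObj (push A) q) d"
    and "\<And>p. p \<in> P \<Longrightarrow> f p \<le> q \<Longrightarrow> colim_desc (below P f q) C A d \<kappa> \<cdot> \<iota> A q p = \<kappa> p"
proof -
  have "is_cocone (below P f q) C A d \<kappa>"
    using d \<kappa> nat unfolding is_cocone_def below_def ball_Hom_poset_cat by simp
  note * = colim_desc[OF below_colimit[OF A] this]
  show "colim_desc (below P f q) C A d \<kappa> \<in> Hom C (FObj (push A) q) d"
    using *(1) by (simp add: pushforward_def)
  show "colim_desc (below P f q) C A d \<kappa> \<cdot> \<iota> A q p = \<kappa> p" if "p \<in> P" "f p \<le> q" for p
    using *(2)[of p] that by (simp add: below_def)
qed

text \<open>The coprojections into a colimit are jointly epic.\<close>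

lemma push_hom_eqI:
  assumes A: "is_module P C A"
    and h: "h \<in> Hom C (FObj (push A) q) d" and h': "h' \<in> Hom C (FObj (push A) q) d"
    and eq: "\<And>p. p \<in> P \<Longrightarrow> f p \<le> q \<Longrightarrow> h \<cdot> \<iota> A q p = h' \<cdot> \<iota> A q p"
  shows "h = h'"
proof -
  have "is_cocone (below P f q) C A d (\<lambda>p. h \<cdot> \<iota> A q p)"
    unfolding is_cocone_def
  proof (intro conjI ballI)
    show "d \<in> Obj C"
      using hom_objD[OF h] by simp
    show "h \<cdot> \<iota> A q x \<in> Hom C (FObj A x) d" if "x \<in> Obj (below P f q)" for x
      using that by (intro comp_hom[OF coproj_hom[OF A] h]) (auto simp: below_def)
    fix x y m assume "x \<in> Obj (below P f q)" "y \<in> Obj (below P f q)" "m \<in> Hom (below P f q) x y"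
    then have xy: "x \<in> P" "f x \<le> q" "y \<in> P" "f y \<le> q" "x \<le> y" "m = (x, y)"
      by (auto simp: below_def split: if_splits)
    show "(h \<cdot> \<iota> A q y) \<cdot> FArr A m = h \<cdot> \<iota> A q x"
      using comp_assoc[OF module_arr[OF A] coproj_hom[OF A] h, of x y] xy
        coproj_natural[OF A] by simp
  qed
  from colimit_arr_eqI[OF below_colimit[OF A] this, of h h'] show ?thesis
    using h h' eq by (simp add: pushforward_def below_def)
qed

lemma push_arr:
  assumes A: "is_module P C A" and "q \<le> q'"
  shows "FArr (push A) (q, q') \<in> Hom C (FObj (push A) q) (FObj (push A) q')"
    and "p \<in> P \<Longrightarrow> f p \<le> q \<Longrightarrow> FArr (push A) (q, q') \<cdot> \<iota> A q p = \<iota> A q' p"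
proof -
  have eq: "FArr (push A) (q, q') = colim_desc (below P f q) C A (FObj (push A) q') (\<iota> A q')"
    by (simp add: pushforward_def)
  have le: "f p \<le> q'" if "f p \<le> q" for p
    using that assms(2) by simp
  show "FArr (push A) (q, q') \<in> Hom C (FObj (push A) q) (FObj (push A) q')"
    unfolding eq by (rule below_desc(1)[OF A push_obj[OF A]]) (simp_all add: coproj_hom coproj_natural A le)
  show "FArr (push A) (q, q') \<cdot> \<iota> A q p = \<iota> A q' p" if "p \<in> P" "f p \<le> q"
    unfolding eq by (rule below_desc(2)[OF A push_obj[OF A]]) (simp_all add: coproj_hom coproj_natural A le that)
qed

lemma push_module:
  assumes A: "is_module P C A"
  shows "is_module Q C (push A)"
  unfolding is_module_iff
proof (intro conjI ballI impI)
  show "FObj (push A) q \<in> Obj C" for q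
    by (rule push_obj[OF A])
  show "FArr (push A) (q, q) = Id C (FObj (push A) q)" for q
  proof (rule push_hom_eqI[OF A push_arr(1)[OF A] id_hom[OF push_obj[OF A]]])
    show "FArr (push A) (q, q) \<cdot> \<iota> A q p = Id C (FObj (push A) q) \<cdot> \<iota> A q p" if "p \<in> P" "f p \<le> q" for p
      using push_arr(2)[OF A _ that] comp_id(2)[OF coproj_hom[OF A that]] by simp
  qed simp
  show "FArr (push A) (x, y) \<in> Hom C (FObj (push A) x) (FObj (push A) y)" if "x \<le> y" for x y
    by (rule push_arr(1)[OF A that])
  fix x y z :: 'q assume xy: "x \<le> y" "y \<le> z"
  show "FArr (push A) (x, z) = FArr (push A) (y, z) \<cdot> FArr (push A) (x, y)"
  proof (rule sym, rule push_hom_eqI[OF A comp_hom[OF push_arr(1)[OF A xy(1)] push_arr(1)[OF A xy(2)]] push_arr(1)[OF A order_trans[OF xy]]])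
    fix p assume p: "p \<in> P" "f p \<le> x"
    show "(FArr (push A) (y, z) \<cdot> FArr (push A) (x, y)) \<cdot> \<iota> A x p = FArr (push A) (x, z) \<cdot> \<iota> A x p"
      using comp_assoc[OF coproj_hom[OF A p] push_arr(1)[OF A xy(1)] push_arr(1)[OF A xy(2)]]
        push_arr(2)[OF A _ p] push_arr(2)[OF A xy(2) p(1)] p xy by simp
  qed
qed

text \<open>The two directions of the adjunction bijection between maps \<open>A \<rightarrow> f\<^sup>* X\<close> and maps \<open>f\<^sub>* A \<rightarrow> X\<close>,
  written with the unit and the counit because these are what relative interleavings are built from.\<close>

definition left_adjunct ::
  "('p, 'o, 'a) pmodule \<Rightarrow> ('q, 'o, 'a) pmodule \<Rightarrow> ('p \<Rightarrow> 'a) \<Rightarrow> 'q \<Rightarrow> 'a" where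
  "left_adjunct A X \<phi> = nt_comp C (counit_hom P f C X) (pushforward_hom P f C A (pullback f X) \<phi>)"

definition right_adjunct :: "('p, 'o, 'a) pmodule \<Rightarrow> ('q \<Rightarrow> 'a) \<Rightarrow> 'p \<Rightarrow> 'a" where
  "right_adjunct A \<alpha> = nt_comp C (pullback_hom f \<alpha>) (unit_hom P f C A)"

lemma counit_component:
  assumes X: "is_module Q C X" and q: "q \<in> Q"
  shows "counit_hom P f C X q \<in> Hom C (FObj (push (pullback f X)) q) (FObj X q)"
    and "\<And>p. p \<in> P \<Longrightarrow> f p \<le> q \<Longrightarrow> counit_hom P f C X q \<cdot> \<iota> (pullback f X) q p = FArr X (f p, q)"
proof -
  note fin = poset_map_in[OF f]
  have hom: "FArr X (f p, q) \<in> Hom C (FObj (pullback f X) p) (FObj X q)" if "p \<in> P" "f p \<le> q" for p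
    using module_arr[OF X fin[OF that(1)] q that(2)] by simp
  have nat: "FArr X (f y, q) \<cdot> FArr (pullback f X) (x, y) = FArr X (f x, q)"
    if "x \<in> P" "y \<in> P" "x \<le> y" "f x \<le> q" "f y \<le> q" for x y
    using module_comp[OF X fin[OF that(1)] fin[OF that(2)] q poset_map_mono[OF f that(1-3)] that(5)] by simp
  note * = below_desc[OF pullback_module[OF f X] module_obj[OF X q], of q "\<lambda>p. FArr X (f p, q)"]
  show "counit_hom P f C X q \<in> Hom C (FObj (push (pullback f X)) q) (FObj X q)"
    unfolding counit_hom_def using hom nat by (rule *(1))
  show "counit_hom P f C X q \<cdot> \<iota> (pullback f X) q p = FArr X (f p, q)" if "p \<in> P" "f p \<le> q" for p
    unfolding counit_hom_def using hom nat that by (rule *(2))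
qed

lemma pushforward_hom_component:
  assumes A: "is_module P C A" and B: "is_module P C B" and \<phi>: "is_module_hom P C A B \<phi>"
  shows "pushforward_hom P f C A B \<phi> q \<in> Hom C (FObj (push A) q) (FObj (push B) q)"
    and "\<And>p. p \<in> P \<Longrightarrow> f p \<le> q \<Longrightarrow> pushforward_hom P f C A B \<phi> q \<cdot> \<iota> A q p = \<iota> B q p \<cdot> \<phi> p"
proof -
  have hom: "\<iota> B q p \<cdot> \<phi> p \<in> Hom C (FObj A p) (FObj (push B) q)" if "p \<in> P" "f p \<le> q" for p
    by (rule comp_hom[OF module_hom_hom[OF \<phi> that(1)] coproj_hom[OF B that]])
  have nat: "(\<iota> B q y \<cdot> \<phi> y) \<cdot> FArr A (x, y) = \<iota> B q x \<cdot> \<phi> x"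
    if xy: "x \<in> P" "y \<in> P" "x \<le> y" "f x \<le> q" "f y \<le> q" for x y
  proof -
    have "(\<iota> B q y \<cdot> \<phi> y) \<cdot> FArr A (x, y) = \<iota> B q y \<cdot> (FArr B (x, y) \<cdot> \<phi> x)"
      using comp_assoc[OF module_arr[OF A xy(1-3)] module_hom_hom[OF \<phi> xy(2)] coproj_hom[OF B xy(2,5)]]
        module_hom_natural[OF \<phi> xy(1-3)] by simp
    also have "\<dots> = \<iota> B q x \<cdot> \<phi> x"
      using comp_assoc[OF module_hom_hom[OF \<phi> xy(1)] module_arr[OF B xy(1-3)] coproj_hom[OF B xy(2,5)]]
        coproj_natural[OF B xy(1-3,5)] by simp
    finally show ?thesis .
  qed
  have eq: "pushforward_hom P f C A B \<phi> q
      = colim_desc (below P f q) C A (FObj (push B) q) (\<lambda>p. \<iota> B q p \<cdot> \<phi> p)"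
    by (simp add: pushforward_hom_def pushforward_def)
  note * = below_desc[OF A push_obj[OF B], of q "\<lambda>p. \<iota> B q p \<cdot> \<phi> p"]
  show "pushforward_hom P f C A B \<phi> q \<in> Hom C (FObj (push A) q) (FObj (push B) q)"
    unfolding eq using hom nat by (rule *(1))
  show "pushforward_hom P f C A B \<phi> q \<cdot> \<iota> A q p = \<iota> B q p \<cdot> \<phi> p" if "p \<in> P" "f p \<le> q" for p
    unfolding eq using hom nat that by (rule *(2))
qed

text \<open>The concrete form of the left adjunct, from which its naturality and the triangle identity
  follow: on the coprojection of \<open>p\<close>, it is \<open>\<phi> p\<close> followed by an internal map of \<open>X\<close>.\<close>

lemma left_adjunct_component:
  assumes A: "is_module P C A" and X: "is_module Q C X"
    and \<phi>: "is_module_hom P C A (pullback f X) \<phi>" and q: "q \<in> Q"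
  shows "left_adjunct A X \<phi> q \<in> Hom C (FObj (push A) q) (FObj X q)"
    and "p \<in> P \<Longrightarrow> f p \<le> q \<Longrightarrow> left_adjunct A X \<phi> q \<cdot> \<iota> A q p = FArr X (f p, q) \<cdot> \<phi> p"
proof -
  note fX = pullback_module[OF f X]
  note counit = counit_component[OF X q] and push = pushforward_hom_component[OF A fX \<phi>, where q = q]
  show "left_adjunct A X \<phi> q \<in> Hom C (FObj (push A) q) (FObj X q)"
    unfolding left_adjunct_def nt_comp_def by (rule comp_hom[OF push(1) counit(1)])
  show "left_adjunct A X \<phi> q \<cdot> \<iota> A q p = FArr X (f p, q) \<cdot> \<phi> p" if p: "p \<in> P" "f p \<le> q"
  proof -
    have "left_adjunct A X \<phi> q \<cdot> \<iota> A q p = counit_hom P f C X q \<cdot> (\<iota> (pullback f X) q p \<cdot> \<phi> p)"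
      unfolding left_adjunct_def nt_comp_def
      using comp_assoc[OF coproj_hom[OF A p] push(1) counit(1)] push(2)[OF p] by simp
    also have "\<dots> = (counit_hom P f C X q \<cdot> \<iota> (pullback f X) q p) \<cdot> \<phi> p"
      using comp_assoc[OF module_hom_hom[OF \<phi> p(1)] coproj_hom[OF fX p] counit(1)] by simp
    finally show ?thesis
      using counit(2)[OF p] by simp
  qed
qed

lemma left_adjunct_module_hom:
  assumes A: "is_module P C A" and X: "is_module Q C X"
    and \<phi>: "is_module_hom P C A (pullback f X) \<phi>"
  shows "is_module_hom Q C (push A) X (left_adjunct A X \<phi>)"
  unfolding is_module_hom_iff
proof (intro conjI ballI impI)
  note comps = left_adjunct_component[OF A X \<phi>]
  show "left_adjunct A X \<phi> q \<in> Hom C (FObj (push A) q) (FObj X q)" if "q \<in> Q" for q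
    by (rule comps(1)[OF that])
  fix x y assume xy: "x \<in> Q" "y \<in> Q" "x \<le> y"
  note Axy = push_arr(1)[OF A xy(3)] and Xxy = module_arr[OF X xy]
  show "left_adjunct A X \<phi> y \<cdot> FArr (push A) (x, y) = FArr X (x, y) \<cdot> left_adjunct A X \<phi> x"
  proof (rule push_hom_eqI[OF A comp_hom[OF Axy comps(1)[OF xy(2)]] comp_hom[OF comps(1)[OF xy(1)] Xxy]])
    fix p assume p: "p \<in> P" "f p \<le> x"
    have py: "f p \<le> y"
      using p xy by simp
    have \<phi>p: "\<phi> p \<in> Hom C (FObj A p) (FObj X (f p))"
      using module_hom_hom[OF \<phi> p(1)] by simp
    have fp: "f p \<in> Q"
      by (rule poset_map_in[OF f p(1)])
    have "(left_adjunct A X \<phi> y \<cdot> FArr (push A) (x, y)) \<cdot> \<iota> A x p = FArr X (f p, y) \<cdot> \<phi> p"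
      using comp_assoc[OF coproj_hom[OF A p] Axy comps(1)[OF xy(2)]] push_arr(2)[OF A xy(3) p]
        comps(2)[OF xy(2) p(1) py] by simp
    also have "\<dots> = FArr X (x, y) \<cdot> (FArr X (f p, x) \<cdot> \<phi> p)"
      using comp_assoc[OF \<phi>p module_arr[OF X fp xy(1) p(2)] Xxy] module_comp[OF X fp xy(1,2) p(2) xy(3)]
      by simp
    also have "\<dots> = (FArr X (x, y) \<cdot> left_adjunct A X \<phi> x) \<cdot> \<iota> A x p"
      using comp_assoc[OF coproj_hom[OF A p] comps(1)[OF xy(1)] Xxy] comps(2)[OF xy(1) p] by simp
    finally show "(left_adjunct A X \<phi> y \<cdot> FArr (push A) (x, y)) \<cdot> \<iota> A x p
        = (FArr X (x, y) \<cdot> left_adjunct A X \<phi> x) \<cdot> \<iota> A x p" .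
  qed
qed

lemma right_adjunct_module_hom:
  assumes A: "is_module P C A" and X: "is_module Q C X"
    and \<alpha>: "is_module_hom Q C (push A) X \<alpha>"
  shows "is_module_hom P C A (pullback f X) (right_adjunct A \<alpha>)"
  unfolding is_module_hom_iff
proof (intro conjI ballI impI)
  note fin = poset_map_in[OF f]
  have unit: "\<iota> A (f p) p \<in> Hom C (FObj A p) (FObj (push A) (f p))" if "p \<in> P" for p
    using coproj_hom[OF A that] by simp
  note \<alpha>_hom = module_hom_hom[OF \<alpha> fin]
  show "right_adjunct A \<alpha> p \<in> Hom C (FObj A p) (FObj (pullback f X) p)" if "p \<in> P" for p
    unfolding right_adjunct_def nt_comp_def pullback_hom_def unit_hom_def
    using comp_hom[OF unit \<alpha>_hom] that by simp
  fix x y assume xy: "x \<in> P" "y \<in> P" "x \<le> y"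
  note fxy = poset_map_mono[OF f xy]
  have "right_adjunct A \<alpha> y \<cdot> FArr A (x, y) = \<alpha> (f y) \<cdot> \<iota> A (f y) x"
    unfolding right_adjunct_def nt_comp_def pullback_hom_def unit_hom_def
    using comp_assoc[OF module_arr[OF A xy] unit[OF xy(2)] \<alpha>_hom[OF xy(2)]] coproj_natural[OF A xy] by simp
  also have "\<dots> = (\<alpha> (f y) \<cdot> FArr (push A) (f x, f y)) \<cdot> \<iota> A (f x) x"
    using comp_assoc[OF unit[OF xy(1)] push_arr(1)[OF A fxy] \<alpha>_hom[OF xy(2)]] push_arr(2)[OF A fxy xy(1)]
    by simp
  also have "\<dots> = FArr X (f x, f y) \<cdot> (\<alpha> (f x) \<cdot> \<iota> A (f x) x)"
    using module_hom_natural[OF \<alpha> fin[OF xy(1)] fin[OF xy(2)] fxy]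
      comp_assoc[OF unit[OF xy(1)] \<alpha>_hom[OF xy(1)] module_arr[OF X fin[OF xy(1)] fin[OF xy(2)] fxy]] by simp
  finally show "right_adjunct A \<alpha> y \<cdot> FArr A (x, y) = FArr (pullback f X) (x, y) \<cdot> right_adjunct A \<alpha> x"
    by (simp add: right_adjunct_def nt_comp_def pullback_hom_def unit_hom_def)
qed

lemma right_adjunct_left_adjunct:
  assumes A: "is_module P C A" and X: "is_module Q C X"
    and \<phi>: "is_module_hom P C A (pullback f X) \<phi>" and p: "p \<in> P"
  shows "right_adjunct A (left_adjunct A X \<phi>) p = \<phi> p"
proof -
  have fp: "f p \<in> Q"
    by (rule poset_map_in[OF f p])
  have "right_adjunct A (left_adjunct A X \<phi>) p = FArr X (f p, f p) \<cdot> \<phi> p"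
    using left_adjunct_component(2)[OF A X \<phi> fp p]
    by (simp add: right_adjunct_def nt_comp_def pullback_hom_def unit_hom_def)
  then show ?thesis
    using comp_id(2)[OF module_hom_hom[OF \<phi> p]] by (simp add: module_id[OF X fp])
qed

text \<open>Only the components at points \<open>f p\<close>, precomposed with the unit, enter the hypothesis. They determine the
  component at any \<open>q\<close>, because the coprojection of \<open>p\<close> at \<open>q\<close> is the unit at \<open>p\<close> followed by the
  internal map from \<open>f p\<close> to \<open>q\<close>.\<close>

lemma module_hom_eq_if_right_adjunct_eq:
  assumes A: "is_module P C A"
    and X: "is_module Q C X"
    and \<alpha>: "is_module_hom Q C (push A) X \<alpha>" and \<beta>: "is_module_hom Q C (push A) X \<beta>"
    and eq: "\<And>p. p \<in> P \<Longrightarrow> right_adjunct A \<alpha> p = right_adjunct A \<beta> p"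
    and q: "q \<in> Q"
  shows "\<alpha> q = \<beta> q"
proof (rule push_hom_eqI[OF A module_hom_hom[OF \<alpha> q] module_hom_hom[OF \<beta> q]])
  fix p assume p: "p \<in> P" "f p \<le> q"
  have fp: "f p \<in> Q"
    by (rule poset_map_in[OF f p(1)])
  have *: "\<gamma> q \<cdot> \<iota> A q p = FArr X (f p, q) \<cdot> right_adjunct A \<gamma> p"
    if \<gamma>: "is_module_hom Q C (push A) X \<gamma>" for \<gamma>
  proof -
    have unit: "\<iota> A (f p) p \<in> Hom C (FObj A p) (FObj (push A) (f p))"
      using coproj_hom[OF A p(1)] by simp
    have "\<gamma> q \<cdot> \<iota> A q p = (\<gamma> q \<cdot> FArr (push A) (f p, q)) \<cdot> \<iota> A (f p) p"
      using comp_assoc[OF unit push_arr(1)[OF A p(2)] module_hom_hom[OF \<gamma> q]]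
        push_arr(2)[OF A p(2) p(1)] by simp
    also have "\<dots> = FArr X (f p, q) \<cdot> (\<gamma> (f p) \<cdot> \<iota> A (f p) p)"
      using module_hom_natural[OF \<gamma> fp q p(2)]
        comp_assoc[OF unit module_hom_hom[OF \<gamma> fp] module_arr[OF X fp q p(2)]] by simp
    finally show ?thesis
      by (simp add: right_adjunct_def nt_comp_def pullback_hom_def unit_hom_def)
  qed
  show "\<alpha> q \<cdot> \<iota> A q p = \<beta> q \<cdot> \<iota> A q p"
    using *[OF \<alpha>] *[OF \<beta>] eq[OF p(1)] by simp
qed

end

section \<open>The relative distance is the distance of the pushforwards\<close>

locale relative_interleaving = translated_poset C Q T + cocomplete_poset_map C P Q f
  for C :: "('o, 'a) category" (structure) and P :: "'p::order set" and Q :: "'q::order set"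
    and f :: "'p \<Rightarrow> 'q" and T :: "real \<Rightarrow> 'q \<Rightarrow> 'q"
begin

abbreviation "left_adjunctP \<epsilon> A B \<equiv> left_adjunct A (shiftQ T \<epsilon> (push B))"

lemma composite_module_hom:
  assumes e: "0 \<le> \<epsilon>"
    and M: "is_module Q C M"
    and N: "is_module Q C N"
    and \<phi>: "is_module_hom Q C M (shiftQ T \<epsilon> N) \<phi>"
    and \<psi>: "is_module_hom Q C N (shiftQ T \<epsilon> M) \<psi>"
  shows "is_module_hom Q C M (shiftQ T (2 * \<epsilon>) M)
    (\<lambda>q. FArr M (T \<epsilon> (T \<epsilon> q), T (2 * \<epsilon>) q) \<cdot> (\<psi> (T \<epsilon> q) \<cdot> \<phi> q))"
  using shifted_comp_module_hom[OF e e M M N \<phi> \<psi>] by (simp add: shifted_comp_def)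

lemma internal_module_hom:
  assumes e: "0 \<le> \<epsilon>" and M: "is_module Q C M"
  shows "is_module_hom Q C M (shiftQ T \<epsilon> M) (\<lambda>q. FArr M (q, T \<epsilon> q))"
proof -
  have *: "q \<le> T \<epsilon> q" "T \<epsilon> q \<in> Q" if "q \<in> Q" for q
    using that e by (auto intro: T_ge T_in)
  show ?thesis
    unfolding is_module_hom_iff
    using * module_arr[OF M] T_mono[OF e] by (simp add: module_comp[OF M])
qed

text \<open>Both sides of the absolute equation, \<open>\<alpha>\<close> and \<open>\<beta>\<close> in the proof, are module homomorphisms
  from \<open>f\<^sub>* A\<close> to \<open>T\<^bsub>2\<epsilon>\<^esub>\<^sup>* f\<^sub>* A\<close>, so they agree as soon as their restrictions along the unit do. Those
  restrictions are the two sides of the relative equation.\<close>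

lemma composes_to_internal_push_iff:
  assumes e: "0 \<le> \<epsilon>"
    and A: "is_module P C A" and B: "is_module P C B"
    and \<phi>: "is_module_hom P C A (shiftP P f T C \<epsilon> B) \<phi>"
    and \<psi>: "is_module_hom P C B (shiftP P f T C \<epsilon> A) \<psi>"
  shows "composes_to_internal Q T C \<epsilon> (push A) (left_adjunctP \<epsilon> A B \<phi>) (left_adjunctP \<epsilon> B A \<psi>) \<longleftrightarrow>
    (\<forall>p\<in>P. nt_comp C (SigmaP P f T C \<epsilon> \<epsilon> A)
                (nt_comp C (shiftP_hom P f T C \<epsilon> B (shiftP P f T C \<epsilon> A) \<psi>) \<phi>) p
           = nt_comp C (etaP2 P f T C 0 (2 * \<epsilon>) A) (etaP P f T C 0 A) p)"
proof -
  let ?M = "push A" and ?N = "push B"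
  let ?\<Phi> = "left_adjunctP \<epsilon> A B \<phi>" and ?\<Psi> = "left_adjunctP \<epsilon> B A \<psi>"
  define \<alpha> where "\<alpha> = (\<lambda>q. FArr ?M (T \<epsilon> (T \<epsilon> q), T (2 * \<epsilon>) q) \<cdot> (?\<Psi> (T \<epsilon> q) \<cdot> ?\<Phi> q))"
  define \<beta> where "\<beta> = (\<lambda>q. FArr ?M (q, T (2 * \<epsilon>) q))"
  note M = push_module[OF A] and N = push_module[OF B]
  note X = shiftQ_module[OF e M] and Y = shiftQ_module[OF e N]
  have \<phi>': "is_module_hom P C A (pullback f (shiftQ T \<epsilon> ?N)) \<phi>"
    using \<phi> by (simp add: shiftP_def)
  have \<psi>': "is_module_hom P C B (pullback f (shiftQ T \<epsilon> ?M)) \<psi>"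
    using \<psi> by (simp add: shiftP_def)
  note \<Phi> = left_adjunct_module_hom[OF A Y \<phi>'] and \<Psi> = left_adjunct_module_hom[OF B X \<psi>']
  have \<alpha>: "is_module_hom Q C ?M (shiftQ T (2 * \<epsilon>) ?M) \<alpha>"
    unfolding \<alpha>_def by (rule composite_module_hom[OF e M N \<Phi> \<Psi>])
  have \<beta>: "is_module_hom Q C ?M (shiftQ T (2 * \<epsilon>) ?M) \<beta>"
    unfolding \<beta>_def by (rule internal_module_hom) (use e M in auto)
  have \<alpha>_eq: "right_adjunct A \<alpha> p = nt_comp C (SigmaP P f T C \<epsilon> \<epsilon> A)
      (nt_comp C (shiftP_hom P f T C \<epsilon> B (shiftP P f T C \<epsilon> A) \<psi>) \<phi>) p" if p: "p \<in> P" for p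
  proof -
    define r where "r = T \<epsilon> (f p)"
    have q: "f p \<in> Q" "r \<in> Q" "T \<epsilon> r \<in> Q" "T (2 * \<epsilon>) (f p) \<in> Q"
      using e poset_map_in[OF f p] by (auto simp: r_def intro!: T_in)
    have le: "T \<epsilon> r \<le> T (2 * \<epsilon>) (f p)"
      unfolding r_def using e q by (intro T_superlinear) auto
    have unit: "\<iota> A (f p) p \<in> Hom C (FObj A p) (FObj ?M (f p))"
      using coproj_hom[OF A p] by simp
    have \<Phi>p: "?\<Phi> (f p) \<in> Hom C (FObj ?M (f p)) (FObj ?N r)"
      using module_hom_hom[OF \<Phi> q(1)] by (simp add: r_def)
    have \<Psi>r: "?\<Psi> r \<in> Hom C (FObj ?N r) (FObj ?M (T \<epsilon> r))"
      using module_hom_hom[OF \<Psi> q(2)] by simp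
    have \<phi>p: "\<phi> p \<in> Hom C (FObj A p) (FObj ?N r)"
      using module_hom_hom[OF \<phi>' p] by (simp add: r_def)
    have "right_adjunct A \<alpha> p = FArr ?M (T \<epsilon> r, T (2 * \<epsilon>) (f p)) \<cdot> (?\<Psi> r \<cdot> (?\<Phi> (f p) \<cdot> \<iota> A (f p) p))"
      using comp_assoc[OF unit comp_hom[OF \<Phi>p \<Psi>r] module_arr[OF M q(3,4) le]]
        comp_assoc[OF unit \<Phi>p \<Psi>r]
      by (simp add: right_adjunct_def nt_comp_def pullback_hom_def unit_hom_def \<alpha>_def r_def)
    also have "?\<Phi> (f p) \<cdot> \<iota> A (f p) p = \<phi> p"
      using right_adjunct_left_adjunct[OF A Y \<phi>' p]
      by (simp add: right_adjunct_def nt_comp_def pullback_hom_def unit_hom_def)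
    finally have 1: "right_adjunct A \<alpha> p = FArr ?M (T \<epsilon> r, T (2 * \<epsilon>) (f p)) \<cdot> (?\<Psi> r \<cdot> \<phi> p)" .
    \<comment> \<open>the counit in the relative \<open>\<Sigma>\<close> and the pushforward of \<open>\<psi>\<close> together make up the adjunct of \<open>\<psi>\<close>\<close>
    have \<chi>: "counit_hom P f C (shiftQ T \<epsilon> ?M) r
        \<in> Hom C (FObj (push (shiftP P f T C \<epsilon> A)) r) (FObj ?M (T \<epsilon> r))"
      using counit_component(1)[OF X q(2)] by (simp add: shiftP_def)
    have push\<psi>: "pushforward_hom P f C B (shiftP P f T C \<epsilon> A) \<psi> r
        \<in> Hom C (FObj ?N r) (FObj (push (shiftP P f T C \<epsilon> A)) r)"
      using pushforward_hom_component(1)[OF B pullback_module[OF f X] \<psi>'] by (simp add: shiftP_def)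
    have "?\<Psi> r \<cdot> \<phi> p = counit_hom P f C (shiftQ T \<epsilon> ?M) r
        \<cdot> (pushforward_hom P f C B (shiftP P f T C \<epsilon> A) \<psi> r \<cdot> \<phi> p)"
      using comp_assoc[OF \<phi>p push\<psi> \<chi>] by (simp add: left_adjunct_def nt_comp_def shiftP_def)
    then show ?thesis
      using 1 comp_assoc[OF comp_hom[OF \<phi>p push\<psi>] \<chi> module_arr[OF M q(3,4) le]]
      by (simp add: nt_comp_def SigmaP_def SigmaQ_def pullback_hom_def shiftQ_hom_def shiftP_hom_def r_def)
  qed
  have \<beta>_eq: "right_adjunct A \<beta> p
      = nt_comp C (etaP2 P f T C 0 (2 * \<epsilon>) A) (etaP P f T C 0 A) p" if p: "p \<in> P" for p
  proof -
    have q: "f p \<in> Q" "T 0 (f p) \<in> Q" "T (2 * \<epsilon>) (f p) \<in> Q"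
      using e poset_map_in[OF f p] by (auto intro!: T_in)
    have le: "f p \<le> T 0 (f p)" "T 0 (f p) \<le> T (2 * \<epsilon>) (f p)"
      using e q by (auto intro!: T_ge T_param_mono)
    have unit: "\<iota> A (f p) p \<in> Hom C (FObj A p) (FObj ?M (f p))"
      using coproj_hom[OF A p] by simp
    show ?thesis
      using comp_assoc[OF unit module_arr[OF M q(1,2) le(1)] module_arr[OF M q(2,3) le(2)]]
        module_comp[OF M q le]
      by (simp add: right_adjunct_def nt_comp_def pullback_hom_def unit_hom_def \<beta>_def etaP_def etaP2_def
          etaQ_def etaQ2_def)
  qed
  have "composes_to_internal Q T C \<epsilon> ?M ?\<Phi> ?\<Psi> \<longleftrightarrow> (\<forall>q\<in>Q. \<alpha> q = \<beta> q)"
    by (simp add: composes_to_internal_def \<alpha>_def \<beta>_def)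
  also have "\<dots> \<longleftrightarrow> (\<forall>p\<in>P. right_adjunct A \<alpha> p = right_adjunct A \<beta> p)"
  proof
    assume "\<forall>q\<in>Q. \<alpha> q = \<beta> q"
    then show "\<forall>p\<in>P. right_adjunct A \<alpha> p = right_adjunct A \<beta> p"
      using poset_map_in[OF f] by (simp add: right_adjunct_def nt_comp_def pullback_hom_def)
  next
    assume *: "\<forall>p\<in>P. right_adjunct A \<alpha> p = right_adjunct A \<beta> p"
    have "is_module Q C (shiftQ T (2 * \<epsilon>) ?M)"
      using e M by (intro shiftQ_module) auto
    then show "\<forall>q\<in>Q. \<alpha> q = \<beta> q"
      using module_hom_eq_if_right_adjunct_eq[OF A _ \<alpha> \<beta>] * by blast
  qed
  finally show ?thesis
    using \<alpha>_eq \<beta>_eq by simp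
qed

lemma weak_interleavingP_iff:
  assumes e: "0 \<le> \<epsilon>"
    and A: "is_module P C A" and B: "is_module P C B"
    and \<phi>: "is_module_hom P C A (shiftP P f T C \<epsilon> B) \<phi>"
    and \<psi>: "is_module_hom P C B (shiftP P f T C \<epsilon> A) \<psi>"
  shows "weak_interleavingP P f T C \<epsilon> A B \<phi> \<psi> \<longleftrightarrow>
    weak_interleavingQ Q T C \<epsilon> (push A) (push B) (left_adjunctP \<epsilon> A B \<phi>) (left_adjunctP \<epsilon> B A \<psi>)"
proof -
  note M = push_module[OF A] and N = push_module[OF B]
  have "is_module_hom Q C (push A) (shiftQ T \<epsilon> (push B)) (left_adjunctP \<epsilon> A B \<phi>)"
    "is_module_hom Q C (push B) (shiftQ T \<epsilon> (push A)) (left_adjunctP \<epsilon> B A \<psi>)"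
    using \<phi> \<psi> by (auto intro!: left_adjunct_module_hom A B shiftQ_module e M N simp: shiftP_def)
  then show ?thesis
    unfolding weak_interleavingP_def weak_interleavingQ_iff[OF e M N]
      composes_to_internal_push_iff[OF e A B \<phi> \<psi>] composes_to_internal_push_iff[OF e B A \<psi> \<phi>]
    using \<phi> \<psi> by simp
qed

text \<open>For the converse direction, an absolute interleaving of the pushforwards agrees on \<open>Q\<close> with the
  left adjuncts of its own right adjuncts, so the previous equivalence applies to the latter.\<close>

lemma weak_interleaving_push_iff:
  assumes e: "0 \<le> \<epsilon>"
    and A: "is_module P C A" and B: "is_module P C B"
  shows "(\<exists>\<phi> \<psi>. weak_interleavingP P f T C \<epsilon> A B \<phi> \<psi>) \<longleftrightarrow>
    (\<exists>\<alpha> \<beta>. weak_interleavingQ Q T C \<epsilon> (push A) (push B) \<alpha> \<beta>)"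
proof
  assume "\<exists>\<phi> \<psi>. weak_interleavingP P f T C \<epsilon> A B \<phi> \<psi>"
  then show "\<exists>\<alpha> \<beta>. weak_interleavingQ Q T C \<epsilon> (push A) (push B) \<alpha> \<beta>"
    using weak_interleavingP_iff[OF e A B] unfolding weak_interleavingP_def by blast
next
  note M = push_module[OF A] and N = push_module[OF B]
  note X = shiftQ_module[OF e M] and Y = shiftQ_module[OF e N]
  assume "\<exists>\<alpha> \<beta>. weak_interleavingQ Q T C \<epsilon> (push A) (push B) \<alpha> \<beta>"
  then obtain \<alpha> \<beta> where \<alpha>\<beta>: "weak_interleavingQ Q T C \<epsilon> (push A) (push B) \<alpha> \<beta>"
    by blast
  then have \<alpha>: "is_module_hom Q C (push A) (shiftQ T \<epsilon> (push B)) \<alpha>"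
    and \<beta>: "is_module_hom Q C (push B) (shiftQ T \<epsilon> (push A)) \<beta>"
    by (simp_all add: weak_interleavingQ_def)
  define \<phi> \<psi> where "\<phi> = right_adjunct A \<alpha>" and "\<psi> = right_adjunct B \<beta>"
  have \<phi>: "is_module_hom P C A (pullback f (shiftQ T \<epsilon> (push B))) \<phi>"
    unfolding \<phi>_def by (rule right_adjunct_module_hom[OF A Y \<alpha>])
  have \<psi>: "is_module_hom P C B (pullback f (shiftQ T \<epsilon> (push A))) \<psi>"
    unfolding \<psi>_def by (rule right_adjunct_module_hom[OF B X \<beta>])
  note \<Phi> = left_adjunct_module_hom[OF A Y \<phi>] and \<Psi> = left_adjunct_module_hom[OF B X \<psi>]
  have \<Phi>_eq: "left_adjunctP \<epsilon> A B \<phi> q = \<alpha> q" if "q \<in> Q" for q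
    using right_adjunct_left_adjunct[OF A Y \<phi>] that
    by (intro module_hom_eq_if_right_adjunct_eq[OF A Y \<Phi> \<alpha>]) (simp_all add: \<phi>_def)
  have \<Psi>_eq: "left_adjunctP \<epsilon> B A \<psi> q = \<beta> q" if "q \<in> Q" for q
    using right_adjunct_left_adjunct[OF B X \<psi>] that
    by (intro module_hom_eq_if_right_adjunct_eq[OF B X \<Psi> \<beta>]) (simp_all add: \<psi>_def)
  have "weak_interleavingQ Q T C \<epsilon> (push A) (push B) (left_adjunctP \<epsilon> A B \<phi>) (left_adjunctP \<epsilon> B A \<psi>)"
    using \<alpha>\<beta> \<Phi> \<Psi> T_in[OF e] unfolding weak_interleavingQ_iff[OF e M N] composes_to_internal_def
    by (simp add: \<Phi>_eq \<Psi>_eq)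
  then have "weak_interleavingP P f T C \<epsilon> A B \<phi> \<psi>"
    using weak_interleavingP_iff[OF e A B] \<phi> \<psi> by (simp add: shiftP_def)
  then show "\<exists>\<phi> \<psi>. weak_interleavingP P f T C \<epsilon> A B \<phi> \<psi>"
    by blast
qed

theorem distP_eq_distQ_push:
  assumes "is_module P C A" "is_module P C B"
  shows "distP P f T C A B = distQ Q T C (push A) (push B)"
  unfolding distP_def distQ_def using weak_interleaving_push_iff[OF _ assms] by metis

end

theorem lemma5p1:
  fixes P :: "'p::order set" and Q :: "'q::order set" and f :: "'p \<Rightarrow> 'q"
    and T :: "real \<Rightarrow> 'q \<Rightarrow> 'q"
    and C :: "('o, 'a) category"
    and M N :: "('q, 'o, 'a) pmodule"
  assumes "poset_map P Q f"
    and "superlinear_family Q T"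
    and "is_category C"
    and "cocomplete TYPE('p) TYPE('p \<times> 'p) C"
    and "is_module Q C M"
    and "is_module Q C N"
  shows "distQ Q T C M N
           \<le> distP P f T C (pullback f M) (pullback f N)
             + (distQ Q T C M (pushforward P f C (pullback f M))
                + distQ Q T C N (pushforward P f C (pullback f N)))
       \<and> distP P f T C (pullback f M) (pullback f N)
           \<le> distQ Q T C M N
             + (distQ Q T C M (pushforward P f C (pullback f M))
                + distQ Q T C N (pushforward P f C (pullback f N)))"
proof -
  interpret relative_interleaving C P Q f T
    by unfold_locales (fact assms)+
  let ?M = "push (pullback f M)" and ?N = "push (pullback f N)"
  let ?d = "distQ Q T C"
  note pulled = pullback_module[OF f assms(5)] pullback_module[OF f assms(6)]
  note mods = assms(5,6) push_module[OF pulled(1)] push_module[OF pulled(2)]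
  have P_eq: "distP P f T C (pullback f M) (pullback f N) = ?d ?M ?N"
    by (rule distP_eq_distQ_push[OF pulled])
  have "?d M N \<le> ?d M ?M + ?d ?M N"
    by (rule distQ_triangle) (fact mods)+
  also have "?d ?M N \<le> ?d ?M ?N + ?d ?N N"
    by (rule distQ_triangle) (fact mods)+
  finally have 1: "?d M N \<le> ?d ?M ?N + (?d M ?M + ?d N ?N)"
    by (simp add: distQ_commute[of ?N N] add_ac)
  have "?d ?M ?N \<le> ?d ?M M + ?d M ?N"
    by (rule distQ_triangle) (fact mods)+
  also have "?d M ?N \<le> ?d M N + ?d N ?N"
    by (rule distQ_triangle) (fact mods)+
  finally have 2: "?d ?M ?N \<le> ?d M N + (?d M ?M + ?d N ?N)"
    by (simp add: distQ_commute[of ?M M] add_ac)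
  show ?thesis
    using 1 2 by (simp add: P_eq)
qed

end
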